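(* Let $\nu,\mu\in\mathbb C$ with $2\mu+1\notin\{0,-1,-2,\ldots\}$. Let $z\in\mathbb C\setminus(-\infty,1]$ lie on an ellipse with foci at $\pm1$, and let $x\in\mathbb C\setminus\big((-\infty,-1]\cup[1,\infty)\big)$ lie in the interior of that ellipse. Then $$\frac{(1-x^2)^{\frac{\mu}{2}}(z^2-1)^{\frac{\nu-\mu-1}{2}}}{(z-x)^\nu}=\sum_{n=0}^\infty\frac{(2\mu+2n+1)\,(\nu)_n\,\Gamma(2\mu+n+1)}{n!}\,{\sf P}_{n+\mu}^{-\mu}(x)\,\boldsymbol{Q}_{n+\mu}^{\nu-\mu-1}(z).$$
   Context: $(a)_0=1$, $(a)_n=a(a+1)\cdots(a+n-1)$; $1/\Gamma$ is the entire reciprocal gamma function. The Ferrers function of the first kind is $${\sf P}_\nu^{-\mu}(x)=\frac{1}{\Gamma(\mu+1)}\left(\frac{1-x}{1+x}\right)^{\frac{\mu}{2}}{}_2F_1\left(-\nu,\nu+1;\mu+1;\frac{1-x}{2}\right)$$ for $x\in(-1,1)$ (with the quotient ${}_2F_1/\Gamma(\mu+1)$ read as its entire extension in $\mu$), and it is extended analytically in $x$ to $\mathbb C\setminus((-\infty,-1]\cup[1,\infty))$. The (Olver-normalized) associated Legendre function of the second kind is $$\boldsymbol{Q}_\nu^\mu(z)=\frac{\sqrt\pi\,(z^2-1)^{\mu/2}}{2^{\nu+1}\,\Gamma(\nu+\frac32)\,z^{\nu+\mu+1}}\,{}_2F_1\left(\frac{\nu+\mu+1}{2},\frac{\nu+\mu+2}{2};\nu+\frac32;\frac{1}{z^2}\right),\qquad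 |z|>1,$$ (with ${}_2F_1/\Gamma(\nu+\frac32)$ read as its entire extension in $\nu$), extended by analytic continuation to $z\in\mathbb C\setminus(-\infty,1]$. Branches: $(z^2-1)^{a}=(z-1)^a(z+1)^a$ with principal powers on $\mathbb C\setminus(-\infty,1]$; $(1-x^2)^{\mu/2}$ is principal; $(z-x)^{-\nu}$, for fixed $z$, is the branch analytic in $x$ in the interior of the ellipse that is principal for $x\in(-1,1)$. *)

theory Defs
  imports "HOL-Complex_Analysis.Complex_Analysis"
begin

text \<open>
  The value at \<open>x\<close> of the holomorphic function on \<open>D\<close> that agrees with \<open>f\<close> on \<open>A\<close>. It is meaningful
  when such a function exists and is determined by its values on \<open>A\<close>, e.g. under the hypotheses
  of \<open>analytic_extension_eq\<close> below; the values of \<open>f\<close> outside \<open>A\<close> are irrelevant.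
\<close>
definition analytic_extension ::
  "(complex \<Rightarrow> complex) \<Rightarrow> complex set \<Rightarrow> complex set \<Rightarrow> complex \<Rightarrow> complex" where
  "analytic_extension f A D x =
     (THE y. \<exists>g. g holomorphic_on D \<and> (\<forall>t\<in>A. g t = f t) \<and> y = g x)"

lemma analytic_extension_eq:
  assumes "open D" "connected D" "A \<subseteq> D" "\<xi> \<in> D" "\<xi> islimpt A"
    and g: "g holomorphic_on D" "\<And>t. t \<in> A \<Longrightarrow> g t = f t" and "x \<in> D"
  shows "analytic_extension f A D x = g x"
proof -
  have "h x = g x" if "h holomorphic_on D" "\<forall>t\<in>A. h t = f t" for h
  proof -
    have "(\<lambda>w. h w - g w) holomorphic_on D"
      using that g by (intro holomorphic_intros)
    then have "h x - g x = 0"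
      by (rule analytic_continuation[where U = A and \<xi> = \<xi>]) (use assms that in auto)
    then show ?thesis by simp
  qed
  then show ?thesis
    unfolding analytic_extension_def using g by (intro the_equality) blast+
qed

text \<open>
  The quotient \<open>\<^sub>2F\<^sub>1(a,b;c;w) / \<Gamma>(c)\<close> for \<open>\<bar>w\<bar> < 1\<close>, as an entire function of \<open>c\<close>: dividing the
  Gauss series termwise by \<open>\<Gamma>(c)\<close> turns \<open>1 / (c)\<^sub>k\<close> into \<open>1 / \<Gamma>(c + k)\<close>.
\<close>
definition hyp2F1_reg :: "complex \<Rightarrow> complex \<Rightarrow> complex \<Rightarrow> complex \<Rightarrow> complex" where
  "hyp2F1_reg a b c w =
     (\<Sum>k. pochhammer a k * pochhammer b k * rGamma (c + of_nat k) / fact k * w ^ k)"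

text \<open>
  The second argument is the superscript (the order), so that \<open>Ferrers_P \<nu> (-\<mu>) x\<close> is
  \<open>P\<^sub>\<nu>\<^sup>-\<^sup>\<mu>(x)\<close>; correspondingly \<open>-m\<close> below is the \<open>\<mu>\<close> of the usual formula.
\<close>
definition Ferrers_P :: "complex \<Rightarrow> complex \<Rightarrow> complex \<Rightarrow> complex" where
  "Ferrers_P \<nu> m =
     analytic_extension
       (\<lambda>t. ((1 - t) / (1 + t)) powr (- m / 2) * hyp2F1_reg (- \<nu>) (\<nu> + 1) (- m + 1) ((1 - t) / 2))
       (complex_of_real ` {-1<..<1})
       (- complex_of_real ` ({..-1} \<union> {1..}))"

text \<open>The branch of \<open>(z\<^sup>2 - 1)\<^sup>a\<close> that is analytic off \<open>(-\<infinity>, 1]\<close> and principal for \<open>z > 1\<close>.\<close>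
definition sq_minus_one_powr :: "complex \<Rightarrow> complex \<Rightarrow> complex" where
  "sq_minus_one_powr z a = (z - 1) powr a * (z + 1) powr a"

text \<open>
  Olver's normalisation of the associated Legendre function of the second kind. The series is used
  for \<open>\<bar>z\<bar> > 1\<close> off the cut, where \<open>z\<close> does not lie on the cut of the principal powers.
\<close>
definition Olver_Q :: "complex \<Rightarrow> complex \<Rightarrow> complex \<Rightarrow> complex" where
  "Olver_Q \<nu> \<mu> =
     analytic_extension
       (\<lambda>z. of_real (sqrt pi) * sq_minus_one_powr z (\<mu> / 2) / (2 powr (\<nu> + 1) * z powr (\<nu> + \<mu> + 1))
            * hyp2F1_reg ((\<nu> + \<mu> + 1) / 2) ((\<nu> + \<mu> + 2) / 2) (\<nu> + 3 / 2) (1 / z ^ 2))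
       ({z. norm z > 1} - complex_of_real ` {..1})
       (- complex_of_real ` {..1})"

text \<open>
  Ellipses with foci \<open>\<plusminus>1\<close>, parametrised by the sum \<open>s\<close> of the focal distances (the length of the
  major axis); they are nondegenerate for \<open>s > 2\<close>.
\<close>
definition confocal_ellipse :: "real \<Rightarrow> complex set" where
  "confocal_ellipse s = {w. dist w 1 + dist w (-1) = s}"

definition confocal_ellipse_interior :: "real \<Rightarrow> complex set" where
  "confocal_ellipse_interior s = {w. dist w 1 + dist w (-1) < s}"

text \<open>
  For \<open>z\<close> on the ellipse, \<open>(z - x)\<^sup>a\<close> as an analytic function of \<open>x\<close> in the interior, principal for
  \<open>x \<in> (-1, 1)\<close>. This differs from the principal power \<open>(z - x) powr a\<close> when \<open>z - x\<close> has crossed the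
  negative real axis.
\<close>
definition diff_powr :: "real \<Rightarrow> complex \<Rightarrow> complex \<Rightarrow> complex \<Rightarrow> complex" where
  "diff_powr s z a =
     analytic_extension (\<lambda>t. (z - t) powr a)
       (complex_of_real ` {-1<..<1}) (confocal_ellipse_interior s)"

end

theory Submission
  imports Defs
begin

text \<open>
  Write \<open>l = \<mu> + 1/2\<close> and let \<open>p\<close> be the solution of \<open>p + 1/p = 2 z\<close> with \<open>\<bar>p\<bar> < 1\<close> (\<open>joukowski z\<close>). Up to
  elementary factors both Legendre functions in the sum are explicit:
  \<open>P\<close> is a multiple of \<open>(1 - x\<^sup>2)\<^sup>\<mu>\<^sup>/\<^sup>2\<close> times the Gegenbauer polynomial \<open>C\<^sub>n\<^sup>l(x)\<close> (\<open>Ferrers_P_eq_gegenbauer\<close>),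
  since both sides satisfy the same three-term recurrence in \<open>n\<close>; and a quadratic transformation turns
  \<open>Q\<close> into \<open>p\<^sup>n\<^sup>+\<^sup>\<nu>\<close> times a Gauss series in \<open>p\<^sup>2\<close> (\<open>Olver_Q_eq\<close>), which converges on the whole slit plane.
  On the other side \<open>2 p (z - x) = 1 - 2 x p + p\<^sup>2\<close>, so \<open>(z - x)\<^sup>-\<^sup>\<nu>\<close> is \<open>(2 p)\<^sup>\<nu>\<close> times the generating function
  \<open>\<Sum>\<^sub>m C\<^sub>m\<^sup>\<nu>(x) p\<^sup>m\<close> (\<open>diff_powr_eq\<close>, \<open>gegenbauer_generating_function\<close>). The claim thus becomes an expansion
  of this generating function in the polynomials \<open>C\<^sub>n\<^sup>l\<close> (\<open>gegenbauer_expansion\<close>), and that is the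
  connection formula for Gegenbauer polynomials with parameters \<open>\<nu>\<close> and \<open>l\<close> (\<open>gegenbauer_connection\<close>)
  followed by a rearrangement of an absolutely convergent double series.

  Convergence is where the ellipse enters: with \<open>2 x = r + 1/r\<close> and \<open>\<bar>r\<bar> \<ge> 1\<close>, the point \<open>x\<close> lies inside the
  confocal ellipse through \<open>z\<close> exactly if \<open>\<bar>r p\<bar> < 1\<close>, while \<open>C\<^sub>n\<^sup>l(x) / r\<^sup>n\<close> grows subexponentially.
\<close>

section \<open>Parameters off the nonpositive integers\<close>

lemma nonpos_Ints_add_of_nat_nz:
  "c \<notin> \<int>\<^sub>\<le>\<^sub>0 \<Longrightarrow> c + of_nat n \<noteq> (0::complex)"
  by (auto dest: plus_of_nat_eq_0_imp)

lemma add_of_nat_notin_nonpos_Ints: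
  fixes c :: complex
  assumes "c \<notin> \<int>\<^sub>\<le>\<^sub>0"
  shows "c + of_nat n \<notin> \<int>\<^sub>\<le>\<^sub>0"
proof
  assume "c + of_nat n \<in> \<int>\<^sub>\<le>\<^sub>0"
  then obtain k where "c + of_nat n = - of_nat k" by (rule nonpos_Ints_cases')
  then have "c + of_nat (n + k) = 0" by (simp add: add.assoc[symmetric])
  then show False using assms plus_of_nat_eq_0_imp by blast
qed

lemma half_notin_nonpos_Ints:
  fixes c :: complex
  assumes "2 * c \<notin> \<int>\<^sub>\<le>\<^sub>0"
  shows "c + 1 / 2 \<notin> \<int>\<^sub>\<le>\<^sub>0" "c \<notin> \<int>\<^sub>\<le>\<^sub>0"
proof -
  have "2 * c = - of_nat (2 * n + 1)" if "c + 1 / 2 = - of_nat n" for n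
  proof -
    have "c = - of_nat n - 1 / 2" using that by (simp add: algebra_simps)
    then show ?thesis by simp
  qed
  then show "c + 1 / 2 \<notin> \<int>\<^sub>\<le>\<^sub>0" using assms minus_of_nat_in_nonpos_Ints nonpos_Ints_cases' by metis
  have "2 * c = - of_nat (2 * n)" if "c = - of_nat n" for n using that by simp
  then show "c \<notin> \<int>\<^sub>\<le>\<^sub>0" using assms minus_of_nat_in_nonpos_Ints nonpos_Ints_cases' by metis
qed

section \<open>Subexponential growth and rearrangement of double series\<close>

text \<open>
  Growth slower than every geometric sequence of ratio \<open>q > 1\<close>. Coefficients with this property give
  power series that converge absolutely in the unit disc, and the property is stable under products.
\<close>
definition subexponential :: "(nat \<Rightarrow> 'a::real_normed_vector) \<Rightarrow> bool" where
  "subexponential f \<longleftrightarrow> (\<forall>q>1. \<exists>K. \<forall>n. norm (f n) \<le> K * q ^ n)"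

lemma subexponentialE:
  assumes "subexponential f" "q > 1"
  obtains K where "K \<ge> 0" "\<And>n. norm (f n) \<le> K * q ^ n"
proof -
  obtain K where K: "\<forall>n. norm (f n) \<le> K * q ^ n"
    using assms unfolding subexponential_def by blast
  have "K \<ge> 0"
    using K[rule_format, of 0] order_trans[OF norm_ge_zero] by fastforce
  with K that show ?thesis by blast
qed

lemma subexponential_if_ratio_le:
  assumes "\<And>q. q > 1 \<Longrightarrow> eventually (\<lambda>n. norm (f (Suc n)) \<le> q * norm (f n)) sequentially"
  shows "subexponential f"
  unfolding subexponential_def
proof (intro allI impI)
  fix q :: real assume q: "q > 1"
  obtain N where N: "\<And>n. n \<ge> N \<Longrightarrow> norm (f (Suc n)) \<le> q * norm (f n)"
    using assms[OF q] unfolding eventually_sequentially by blast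
  define K where "K = (\<Sum>i\<le>N. norm (f i))"
  have K: "norm (f i) \<le> K" if "i \<le> N" for i
    unfolding K_def using that by (intro member_le_sum) auto
  then have "K \<ge> 0" using order_trans[OF norm_ge_zero] by blast
  have "norm (f n) \<le> K * q ^ n" for n
  proof (induction n)
    case 0
    then show ?case using K[of 0] by simp
  next
    case (Suc n)
    show ?case
    proof (cases "n \<ge> N")
      case True
      have "norm (f (Suc n)) \<le> q * norm (f n)" by (rule N[OF True])
      also have "\<dots> \<le> q * (K * q ^ n)" using Suc q by (intro mult_left_mono) auto
      finally show ?thesis by (simp add: mult_ac)
    next
      case False
      then have "norm (f (Suc n)) \<le> K * 1" using K[of "Suc n"] by simp
      also have "\<dots> \<le> K * q ^ Suc n"
        using q \<open>K \<ge> 0\<close> by (intro mult_left_mono one_le_power) auto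
      finally show ?thesis .
    qed
  qed
  then show "\<exists>K. \<forall>n. norm (f n) \<le> K * q ^ n" by blast
qed

lemma subexponential_mult:
  fixes f g :: "nat \<Rightarrow> 'a::real_normed_algebra"
  assumes "subexponential f" "subexponential g"
  shows "subexponential (\<lambda>n. f n * g n)"
  unfolding subexponential_def
proof (intro allI impI)
  fix q :: real assume "q > 1"
  then have q: "sqrt q > 1" by simp
  obtain K where K: "K \<ge> 0" "\<And>n. norm (f n) \<le> K * sqrt q ^ n"
    using subexponentialE[OF assms(1) q] by metis
  obtain L where L: "L \<ge> 0" "\<And>n. norm (g n) \<le> L * sqrt q ^ n"
    using subexponentialE[OF assms(2) q] by metis
  have "norm (f n * g n) \<le> K * L * q ^ n" for n
  proof -
    have "norm (f n * g n) \<le> norm (f n) * norm (g n)" by (rule norm_mult_ineq)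
    also have "\<dots> \<le> (K * sqrt q ^ n) * (L * sqrt q ^ n)"
      using K L q by (intro mult_mono) auto
    also have "\<dots> = K * L * (sqrt q * sqrt q) ^ n"
      unfolding power_mult_distrib by (simp add: mult_ac)
    finally show ?thesis using \<open>q > 1\<close> by simp
  qed
  then show "\<exists>K. \<forall>n. norm (f n * g n) \<le> K * q ^ n" by blast
qed

lemma subexponential_cmult:
  fixes f :: "nat \<Rightarrow> 'a::real_normed_algebra"
  assumes "subexponential f"
  shows "subexponential (\<lambda>n. c * f n)"
  unfolding subexponential_def
proof (intro allI impI)
  fix q :: real assume "q > 1"
  then obtain K where K: "K \<ge> 0" "\<And>n. norm (f n) \<le> K * q ^ n"
    using subexponentialE[OF assms] by metis
  have "norm (c * f n) \<le> (norm c * K) * q ^ n" for n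
    using order_trans[OF norm_mult_ineq mult_left_mono[OF K(2) norm_ge_zero]]
    by (simp add: mult.assoc)
  then show "\<exists>K. \<forall>n. norm (c * f n) \<le> K * q ^ n" by blast
qed

lemma eventually_norm_add_of_nat_le:
  fixes a c :: complex
  assumes "q > 1"
  shows "eventually (\<lambda>n. norm (a + of_nat n) \<le> q * norm (c + of_nat n)) sequentially"
proof -
  have "eventually (\<lambda>n. real n \<ge> (norm a + q * norm c) / (q - 1)) sequentially"
    using filterlim_real_sequentially unfolding filterlim_at_top by blast
  then show ?thesis
  proof eventually_elim
    case (elim n)
    have "norm (a + of_nat n) \<le> norm a + real n"
      using norm_triangle_ineq[of a "of_nat n"] by simp
    also have "\<dots> \<le> q * (real n - norm c)"
      using elim assms by (simp add: field_simps)
    also have "\<dots> \<le> q * norm (c + of_nat n)"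
    proof (intro mult_left_mono)
      show "real n - norm c \<le> norm (c + of_nat n)"
        using norm_triangle_ineq2[of "of_nat n" "- c"] by (simp add: add.commute)
    qed (use assms in auto)
    finally show ?case .
  qed
qed

lemma subexponential_pochhammer_ratio:
  fixes a c :: complex
  assumes "c \<notin> \<int>\<^sub>\<le>\<^sub>0"
  shows "subexponential (\<lambda>n. pochhammer a n / pochhammer c n)"
proof (rule subexponential_if_ratio_le)
  fix q :: real assume q: "q > 1"
  have nz: "c + of_nat n \<noteq> 0" for n
    using assms by (auto dest: plus_of_nat_eq_0_imp)
  show "eventually (\<lambda>n. norm (pochhammer a (Suc n) / pochhammer c (Suc n))
          \<le> q * norm (pochhammer a n / pochhammer c n)) sequentially"
    using eventually_norm_add_of_nat_le[OF q, of a c]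
  proof eventually_elim
    case (elim n)
    have "norm (pochhammer a (Suc n) / pochhammer c (Suc n)) =
          norm (pochhammer a n / pochhammer c n) * (norm (a + of_nat n) / norm (c + of_nat n))"
      by (simp add: pochhammer_Suc norm_mult norm_divide)
    also have "\<dots> \<le> norm (pochhammer a n / pochhammer c n) * q"
      using elim nz[of n] by (intro mult_left_mono) (auto simp: field_simps)
    finally show ?case by (simp add: mult.commute)
  qed
qed

lemma subexponential_pochhammer_fact: "subexponential (\<lambda>n. pochhammer (a::complex) n / fact n)"
  using subexponential_pochhammer_ratio[of 1 a]
  by (simp add: pochhammer_fact[symmetric])

lemma subexponential_of_nat_add: "subexponential (\<lambda>n. of_nat n + (a::complex))"
proof (rule subexponential_if_ratio_le)
  fix q :: real assume q: "q > 1"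
  show "eventually (\<lambda>n. norm (of_nat (Suc n) + a) \<le> q * norm (of_nat n + a)) sequentially"
    using eventually_norm_add_of_nat_le[OF q, of "a + 1" a] by (simp add: add_ac)
qed

lemma summable_subexponential:
  fixes f :: "nat \<Rightarrow> complex"
  assumes "subexponential f" "norm w < 1"
  shows "summable (\<lambda>n. norm (f n * w ^ n))"
proof -
  obtain q where q: "q > 1" "q * norm w < 1"
  proof (cases "w = 0")
    case False
    obtain q where "1 < q" "q < 1 / norm w"
      using dense[of 1 "1 / norm w"] assms False by auto
    with False that show ?thesis by (auto simp: field_simps)
  qed (use that[of 2] in auto)
  obtain K where K: "K \<ge> 0" "\<And>n. norm (f n) \<le> K * q ^ n"
    using subexponentialE[OF assms(1) q(1)] by metis
  show ?thesis
  proof (rule summable_comparison_test'[where N = 0])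
    show "summable (\<lambda>n. K * (q * norm w) ^ n)"
      using q by (intro summable_mult summable_geometric) auto
    show "norm (norm (f n * w ^ n)) \<le> K * (q * norm w) ^ n" for n
      using mult_right_mono[OF K(2)[of n], of "norm w ^ n"]
      by (simp add: norm_mult norm_power power_mult_distrib mult_ac)
  qed
qed

text \<open>
  An absolutely convergent double series may be summed along the fibres of any map with finite
  fibres, and also along its rows; both give the same value.
\<close>
lemma sums_over_fibres:
  fixes f :: "nat \<times> nat \<Rightarrow> complex"
  assumes "(\<lambda>p. norm (f p)) summable_on UNIV" and fin: "\<And>m. finite {p. \<phi> p = m}"
  shows "(\<lambda>m. \<Sum>p | \<phi> p = m. f p) sums infsum f UNIV"
proof -
  have s: "f summable_on UNIV" using assms(1) by (rule abs_summable_summable)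
  have 1: "bij_betw snd (Sigma UNIV (\<lambda>m. {p. \<phi> p = m})) UNIV"
    by (rule bij_betwI[where g = "\<lambda>p. (\<phi> p, p)"]) auto
  have "(f has_sum infsum f UNIV) UNIV" using s by simp
  then have 2: "((\<lambda>p. f (snd p)) has_sum infsum f UNIV) (Sigma UNIV (\<lambda>m. {p. \<phi> p = m}))"
    using has_sum_reindex_bij_betw[OF 1] by fastforce
  show ?thesis
  proof (rule has_sum_imp_sums, rule has_sum_SigmaD[OF 2])
    show "((\<lambda>p. f (snd (m, p))) has_sum (\<Sum>p | \<phi> p = m. f p)) {p. \<phi> p = m}" for m
      using fin by (auto intro: has_sum_finite)
  qed
qed

lemma sums_over_rows:
  fixes f :: "nat \<times> nat \<Rightarrow> complex"
  assumes "(\<lambda>p. norm (f p)) summable_on UNIV" and row: "\<And>n. (\<lambda>k. f (n, k)) sums r n"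
  shows "r sums infsum f UNIV"
proof -
  have s: "f summable_on UNIV \<times> UNIV" using assms(1) by (auto intro: abs_summable_summable)
  have "(f has_sum infsum f UNIV) (UNIV \<times> UNIV)" using s by simp
  then show ?thesis
  proof (rule has_sum_imp_sums[OF has_sum_SigmaD])
    fix n :: nat
    have "(\<lambda>k. f (n, k)) summable_on UNIV"
      using summable_on_SigmaD1[of "\<lambda>n k. f (n, k)" UNIV "\<lambda>_. UNIV" n] s by simp
    then obtain t where t: "((\<lambda>k. f (n, k)) has_sum t) UNIV"
      by (auto simp: summable_on_def)
    moreover have "t = r n" using has_sum_imp_sums[OF t] row sums_unique2 by blast
    ultimately show "((\<lambda>k. f (n, k)) has_sum r n) UNIV" by simp
  qed
qed

lemma abs_summable_geometric_bound:
  fixes f :: "nat \<times> nat \<Rightarrow> complex"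
  assumes bd: "\<And>n k. norm (f (n, k)) \<le> K * A ^ n * B ^ k"
    and A: "0 \<le> A" "A < 1" and B: "0 \<le> B" "B < 1"
  shows "(\<lambda>p. norm (f p)) summable_on UNIV"
proof -
  have g: "(\<lambda>n. C ^ n) summable_on UNIV" if "0 \<le> C" "C < 1" for C :: real
    using that by (intro norm_summable_imp_summable_on) (auto intro: summable_geometric)
  have "(\<lambda>(n, k). A ^ n * B ^ k) summable_on UNIV \<times> UNIV"
  proof (rule summable_on_SigmaI[where g = "\<lambda>n. A ^ n * infsum (\<lambda>k. B ^ k) UNIV"])
    show "((\<lambda>k. case (n, k) of (n, k) \<Rightarrow> A ^ n * B ^ k) has_sum A ^ n * (\<Sum>\<^sub>\<infinity>k. B ^ k)) UNIV" for n
      using has_sum_cmult_right[OF has_sum_infsum[OF g[OF B]]] by simp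
  qed (use A B in \<open>auto intro!: summable_on_cmult_left g\<close>)
  then have "(\<lambda>p. K * (case p of (n, k) \<Rightarrow> A ^ n * B ^ k)) summable_on UNIV"
    by (intro summable_on_cmult_right) simp
  then show ?thesis
    by (rule summable_on_comparison_test) (use bd in \<open>auto simp: mult_ac\<close>)
qed

section \<open>Gegenbauer polynomials and their generating function\<close>

text \<open>
  The Gegenbauer polynomial \<open>C\<^sub>n\<^sup>l(x)\<close>, defined by its three-term recurrence. In contrast to the usual
  hypergeometric formula this makes sense for every complex parameter \<open>l\<close>.
\<close>
fun gegenbauer :: "complex \<Rightarrow> nat \<Rightarrow> complex \<Rightarrow> complex" where
  "gegenbauer l 0 x = 1"
| "gegenbauer l (Suc 0) x = 2 * l * x"
| "gegenbauer l (Suc (Suc n)) x =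
     (2 * x * (of_nat n + 1 + l) * gegenbauer l (Suc n) x - (of_nat n + 2 * l) * gegenbauer l n x) /
         (of_nat n + 2)"

lemma gegenbauer_unique:
  assumes "f 0 = 1" "f (Suc 0) = 2 * l * x"
    and rec: "\<And>n. (of_nat n + 2) * f (Suc (Suc n)) =
        2 * x * (of_nat n + 1 + l) * f (Suc n) - (of_nat n + 2 * l) * f n"
  shows "f n = gegenbauer l n x"
proof (induction n rule: induct_nat_012)
  case (ge2 n)
  have "of_nat n + 2 \<noteq> (0::complex)"
    by (metis of_nat_add of_nat_eq_0_iff of_nat_numeral add_is_0 zero_neq_numeral)
  with rec[of n] ge2 show ?case by (simp add: field_simps)
qed (use assms in auto)

lemma holomorphic_on_gegenbauer [holomorphic_intros]:
  "f holomorphic_on S \<Longrightarrow> (\<lambda>x. gegenbauer l n (f x)) holomorphic_on S"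
proof (induction n rule: induct_nat_012)
  case (ge2 n)
  have "of_nat n + 2 \<noteq> (0::complex)"
    by (metis of_nat_add of_nat_eq_0_iff of_nat_numeral add_is_0 zero_neq_numeral)
  with ge2 show ?case by (auto intro!: holomorphic_intros)
qed (auto intro!: holomorphic_intros)

text \<open>
  The power series \<open>(1 - r X)\<^sup>-\<^sup>l\<close>.
\<close>
definition binomial_fps :: "complex \<Rightarrow> complex \<Rightarrow> complex fps" where
  "binomial_fps l r = Abs_fps (\<lambda>i. pochhammer l i / fact i * r ^ i)"

lemma binomial_fps_deriv: "(1 - fps_const r * fps_X) * fps_deriv (binomial_fps l r) = fps_const (l * r) *
    binomial_fps l r"
proof (rule fps_ext)
  fix n
  define a where "a = (\<lambda>i. pochhammer l i / fact i * r ^ i)"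
  have *: "of_nat (Suc n) * a (Suc n) = (l + of_nat n) * r * a n" for n
    unfolding a_def by (simp add: pochhammer_Suc mult_ac add.commute del: of_nat_Suc)
  have a: "binomial_fps l r = Abs_fps a" by (simp add: binomial_fps_def a_def)
  show "((1 - fps_const r * fps_X) * fps_deriv (binomial_fps l r)) $ n = (fps_const (l * r) * binomial_fps
      l r) $ n"
  proof (cases n)
    case 0
    then show ?thesis using *[of 0] by (simp add: a left_diff_distrib mult.assoc)
  next
    case (Suc m)
    have "((1 - fps_const r * fps_X) * fps_deriv (binomial_fps l r)) $ n =
        of_nat (Suc n) * a (Suc n) - r * (of_nat n * a n)"
      by (simp add: a left_diff_distrib mult.assoc Suc)
    then show ?thesis unfolding * by (simp add: a algebra_simps)
  qed
qed

text \<open>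
  With \<open>x = (r + 1/r) / 2\<close> one has \<open>1 - 2 x X + X\<^sup>2 = (1 - r X) (1 - X/r)\<close>. The coefficients of
  \<open>(1 - r X)\<^sup>-\<^sup>l (1 - X/r)\<^sup>-\<^sup>l\<close> satisfy the Gegenbauer recurrence because of the first-order differential
  equation of this product.
\<close>
lemma gegenbauer_eq_binomial_fps_mult:
  assumes "r * r' = 1" "r + r' = 2 * x"
  shows "gegenbauer l n x = (binomial_fps l r * binomial_fps l r') $ n"
proof (rule gegenbauer_unique[symmetric])
  define P where "P = binomial_fps l r * binomial_fps l r'"
  have ring: "(A' * B + A * B') - (a + b) * (X * (A' * B + A * B')) + X ^ 2 * (A' * B + A * B') =
      L * (a + b) * (A * B) - 2 * L * (X * (A * B))"
    if "a * b = 1" "(1 - a * X) * A' = L * a * A" "(1 - b * X) * B' = L * b * B"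
    for a b A A' B B' L X :: "complex fps"
  proof -
    have "(A' * B + A * B') - (a + b) * (X * (A' * B + A * B')) + X ^ 2 * (A' * B + A * B') =
       ((1 - a * X) * A') * ((1 - b * X) * B) + ((1 - b * X) * B') * ((1 - a * X) * A) +
       (1 - a * b) * (X ^ 2 * (A' * B + A * B'))"
      by (simp add: algebra_simps power2_eq_square)
    also have "\<dots> = (L * a * A) * ((1 - b * X) * B) + (L * b * B) * ((1 - a * X) * A)"
      using that by simp
    also have "\<dots> = L * (a + b) * (A * B) - 2 * L * (a * b) * (X * (A * B))"
      by (simp add: algebra_simps)
    finally show ?thesis using that by simp
  qed
  have "fps_deriv P = fps_deriv (binomial_fps l r) * binomial_fps l r' + binomial_fps l r * fps_deriv
      (binomial_fps l r')"
    unfolding P_def by (simp add: add.commute)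
  then have D: "fps_deriv P - fps_const (2 * x) * (fps_X * fps_deriv P) + fps_X ^ 2 * fps_deriv P =
      fps_const (2 * l * x) * P - fps_const (2 * l) * (fps_X * P)"
    using ring[of "fps_const r" "fps_const r'" fps_X "fps_deriv (binomial_fps l r)" "fps_const l"
        "binomial_fps l r"
        "fps_deriv (binomial_fps l r')" "binomial_fps l r'"] binomial_fps_deriv[of r l]
            binomial_fps_deriv[of r' l] assms
    by (simp add: numeral_fps_const mult.assoc mult.left_commute[of l 2 x] flip: P_def)
  show "(binomial_fps l r * binomial_fps l r') $ 0 = 1"
    by (simp add: binomial_fps_def)
  have "(binomial_fps l r * binomial_fps l r') $ Suc 0 = l * (r + r')"
    by (simp add: binomial_fps_def fps_mult_nth algebra_simps)
  then show "(binomial_fps l r * binomial_fps l r') $ Suc 0 = 2 * l * x"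
    using assms by simp
  fix n
  from arg_cong[OF D, of "\<lambda>F. F $ Suc n"]
  show "(of_nat n + 2) * (binomial_fps l r * binomial_fps l r') $ Suc (Suc n) =
      2 * x * (of_nat n + 1 + l) * (binomial_fps l r * binomial_fps l r') $ Suc n -
      (of_nat n + 2 * l) * (binomial_fps l r * binomial_fps l r') $ n"
    unfolding P_def[symmetric]
    by (cases n) (simp_all add: power2_eq_square mult.assoc, simp_all add: algebra_simps)
qed

lemma gegenbauer_eq_sum:
  assumes "r * r' = 1" "r + r' = 2 * x"
  shows "gegenbauer l n x = (\<Sum>i\<le>n. (pochhammer l i / fact i * r ^ i) * (pochhammer l (n - i) / fact (n -
      i) * r' ^ (n - i)))"
  by (simp add: gegenbauer_eq_binomial_fps_mult[OF assms] fps_mult_nth binomial_fps_def atMost_atLeast0)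

lemma sums_neg_powr:
  fixes a w :: complex
  assumes "norm w < 1"
  shows "(\<lambda>n. pochhammer a n / fact n * w ^ n) sums (1 - w) powr (- a)"
proof -
  have "(\<lambda>n. (- a gchoose n) * (- w) ^ n) sums (1 + (- w)) powr (- a)"
    using assms by (intro gen_binomial_complex) auto
  moreover have "(- a gchoose n) * (- w) ^ n = pochhammer a n / fact n * w ^ n" for n
    by (simp add: gbinomial_pochhammer power_minus[of w])
  ultimately show ?thesis by simp
qed

lemma Ln_mult_Re_pos:
  assumes "Re a > 0" "Re b > 0"
  shows "Ln (a * b) = Ln a + Ln b" and "a * b \<notin> \<real>\<^sub>\<le>\<^sub>0"
proof -
  have "a \<noteq> 0" "b \<noteq> 0" using assms by auto
  moreover have "\<bar>Im (Ln a)\<bar> < pi / 2" "\<bar>Im (Ln b)\<bar> < pi / 2"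
    using assms Re_Ln_pos_lt \<open>a \<noteq> 0\<close> \<open>b \<noteq> 0\<close> by auto
  ultimately show 1: "Ln (a * b) = Ln a + Ln b"
    by (intro Ln_times_simple) auto
  have "\<bar>Im (Ln (a * b))\<bar> < pi"
    unfolding 1 using \<open>\<bar>Im (Ln a)\<bar> < pi / 2\<close> \<open>\<bar>Im (Ln b)\<bar> < pi / 2\<close> by auto
  then have pi: "Im (Ln (a * b)) \<noteq> pi" by auto
  show "a * b \<notin> \<real>\<^sub>\<le>\<^sub>0"
  proof
    assume "a * b \<in> \<real>\<^sub>\<le>\<^sub>0"
    then have im: "Im (a * b) = 0" and "Re (a * b) \<le> 0"
      by (simp_all only: complex_nonpos_Reals_iff)
    moreover have nz: "a * b \<noteq> 0" using \<open>a \<noteq> 0\<close> \<open>b \<noteq> 0\<close> by simp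
    then have "Re (a * b) \<noteq> 0" using im complex_eqI[of "a * b" 0] by fastforce
    ultimately show False using Im_Ln_eq_pi[OF nz] pi by linarith
  qed
qed

text \<open>
  Both factors \<open>1 - r w\<close> and \<open>1 - w/r\<close> lie in the right half-plane, so the principal power of their
  product is the product of the principal powers, and the product avoids the branch cut.
\<close>
lemma gegenbauer_generating_function:
  assumes r: "r * r' = 1" "r + r' = 2 * x" and w: "norm (r * w) < 1" "norm (r' * w) < 1"
  shows "(\<lambda>n. gegenbauer l n x * w ^ n) sums (1 - 2 * x * w + w ^ 2) powr (- l)"
    and "1 - 2 * x * w + w ^ 2 \<notin> \<real>\<^sub>\<le>\<^sub>0"
proof -
  let ?a = "\<lambda>r n. pochhammer l n / fact n * (r * w) ^ n"
  have eq: "1 - 2 * x * w + w ^ 2 = (1 - r * w) * (1 - r' * w)"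
    using r unfolding r(2)[symmetric] by algebra
  have pos: "Re (1 - r * w) > 0" "Re (1 - r' * w) > 0"
    using w complex_Re_le_cmod[of "r * w"] complex_Re_le_cmod[of "r' * w"] by auto
  show "1 - 2 * x * w + w ^ 2 \<notin> \<real>\<^sub>\<le>\<^sub>0"
    unfolding eq by (rule Ln_mult_Re_pos[OF pos])
  have "1 - r * w \<noteq> 0" "1 - r' * w \<noteq> 0" using pos by force+
  then have "(1 - 2 * x * w + w ^ 2) powr (- l) = (1 - r * w) powr (- l) * (1 - r' * w) powr (- l)"
    unfolding eq powr_def Ln_mult_Re_pos(1)[OF pos] by (simp add: distrib_left flip: exp_add)
  also have "\<dots> = (\<Sum>n. ?a r n) * (\<Sum>n. ?a r' n)"
    using sums_neg_powr[OF w(1), of l] sums_neg_powr[OF w(2), of l] by (simp add: sums_iff)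
  finally have "(1 - 2 * x * w + w ^ 2) powr (- l) = (\<Sum>n. ?a r n) * (\<Sum>n. ?a r' n)" .
  moreover have "(\<lambda>n. \<Sum>i\<le>n. ?a r i * ?a r' (n - i)) sums ((\<Sum>n. ?a r n) * (\<Sum>n. ?a r' n))"
    using w by (intro Cauchy_product_sums summable_subexponential subexponential_pochhammer_fact)
  moreover have "(\<Sum>i\<le>n. ?a r i * ?a r' (n - i)) = gegenbauer l n x * w ^ n" for n
    unfolding gegenbauer_eq_sum[OF r] sum_distrib_right
    by (intro sum.cong) (auto simp: power_mult_distrib mult_ac simp flip: power_add)
  ultimately show "(\<lambda>n. gegenbauer l n x * w ^ n) sums (1 - 2 * x * w + w ^ 2) powr (- l)" by simp
qed

lemma gegenbauer_subexponential:
  assumes r: "r * r' = 1" "r + r' = 2 * x" and "norm r \<ge> 1" 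
  shows "subexponential (\<lambda>n. gegenbauer l n x / r ^ n)"
  unfolding subexponential_def
proof (intro allI impI)
  fix q :: real assume "q > 1"
  then have q: "sqrt q > 1" by simp
  obtain K where K: "K \<ge> 0" "\<And>n. norm (pochhammer l n / fact n) \<le> K * sqrt q ^ n"
    using subexponentialE[OF subexponential_pochhammer_fact q] by metis
  obtain L where L: "L \<ge> 0" "\<And>n. norm (of_nat n + 1 :: complex) \<le> L * sqrt q ^ n"
    using subexponentialE[OF subexponential_of_nat_add q] by metis
  have "norm r * norm r' = 1" using r(1) by (metis norm_mult norm_one)
  moreover have "1 * norm r' \<le> norm r * norm r'" using \<open>norm r \<ge> 1\<close> by (intro mult_right_mono) auto
  moreover have "r \<noteq> 0" using \<open>norm r \<ge> 1\<close> by auto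
  ultimately have r': "norm r' \<le> 1" "r \<noteq> 0" by simp_all
  have "norm (gegenbauer l n x / r ^ n) \<le> (K * K * L) * q ^ n" for n
  proof -
    have "norm (gegenbauer l n x) \<le> (\<Sum>i\<le>n. norm ((pochhammer l i / fact i * r ^ i) * (pochhammer l (n - i)
        / fact (n - i) * r' ^ (n - i))))"
      unfolding gegenbauer_eq_sum[OF r] by (rule norm_sum)
    also have "\<dots> \<le> (\<Sum>i\<le>n. K * K * sqrt q ^ n * norm r ^ n)"
    proof (rule sum_mono)
      fix i assume i: "i \<in> {..n}"
      have "norm ((pochhammer l i / fact i * r ^ i) * (pochhammer l (n - i) / fact (n - i) * r' ^ (n - i))) =
         norm (pochhammer l i / fact i) * norm (pochhammer l (n - i) / fact (n - i)) * (norm r ^ i * norm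
             r' ^ (n - i))"
        by (simp add: norm_mult norm_power norm_divide)
      also have "\<dots> \<le> (K * sqrt q ^ i) * (K * sqrt q ^ (n - i)) * (norm r ^ n * 1)"
        using K r' i \<open>norm r \<ge> 1\<close> \<open>q > 1\<close>
        by (intro mult_mono power_increasing power_le_one) (auto intro!: mult_nonneg_nonneg)
      also have "\<dots> = K * K * (sqrt q ^ i * sqrt q ^ (n - i)) * norm r ^ n" by (simp add: mult_ac)
      also have "sqrt q ^ i * sqrt q ^ (n - i) = sqrt q ^ n" using i by (simp flip: power_add)
      finally show "norm ((pochhammer l i / fact i * r ^ i) * (pochhammer l (n - i) / fact (n - i) * r' ^
          (n - i)))
         \<le> K * K * sqrt q ^ n * norm r ^ n" .
    qed
    also have "\<dots> = K * K * sqrt q ^ n * norm r ^ n * norm (of_nat n + 1 :: complex)"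
      by (simp add: norm_of_nat[where 'a = complex, symmetric] add.commute del: norm_of_nat flip: of_nat_Suc)
    also have "\<dots> \<le> K * K * sqrt q ^ n * norm r ^ n * (L * sqrt q ^ n)"
      using K(1) L \<open>q > 1\<close> by (intro mult_left_mono) auto
    also have "\<dots> = K * K * L * (sqrt q * sqrt q) ^ n * norm r ^ n"
      unfolding power_mult_distrib by (simp add: mult_ac)
    finally show ?thesis using r' \<open>q > 1\<close> by (simp add: norm_divide norm_power divide_simps)
  qed
  then show "\<exists>K. \<forall>n. norm (gegenbauer l n x / r ^ n) \<le> K * q ^ n" by blast
qed

section \<open>The connection formula\<close>

text \<open>
  Gegenbauer polynomials indexed by integers and vanishing for negative index; with this convention
  the three-term recurrence holds at every integer and sums over \<open>k\<close> need no boundary terms.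
\<close>
definition gegenbauer_int :: "complex \<Rightarrow> int \<Rightarrow> complex \<Rightarrow> complex" where
  "gegenbauer_int l j x = (if j < 0 then 0 else gegenbauer l (nat j) x)"

lemma gegenbauer_int_recurrence:
  "2 * x * (of_int j + l) * gegenbauer_int l j x =
   (of_int j + 1) * gegenbauer_int l (j + 1) x + (of_int j + 2 * l - 1) * gegenbauer_int l (j - 1) x"
proof -
  consider "j < -1" | "j = -1" | "j = 0" | "j \<ge> 1" by linarith
  then show ?thesis
  proof cases
    case 4
    then obtain n where 4: "j = int (Suc n)"
      using that[of "nat (j - 1)"] by simp
    have "of_nat n + 2 \<noteq> (0::complex)"
      by (metis of_nat_add of_nat_eq_0_iff of_nat_numeral add_is_0 zero_neq_numeral)
    moreover have "nat (int n + 2) = Suc (Suc n)" "nat (1 + int n) = Suc n" by auto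
    ultimately show ?thesis unfolding 4 gegenbauer_int_def
      by (simp add: field_simps)
  qed (auto simp: gegenbauer_int_def)
qed

text \<open>
  The coefficient of \<open>(n + l) C\<^sub>n\<^sup>l\<close> in the expansion of \<open>C\<^sub>m\<^sup>v\<close>, where \<open>n = m - 2 k\<close> and \<open>d = m - k\<close>.
\<close>
definition connection_coeff :: "complex \<Rightarrow> complex \<Rightarrow> nat \<Rightarrow> nat \<Rightarrow> complex" where
  "connection_coeff v l d k = pochhammer v d * pochhammer (v - l) k / (fact k * pochhammer l (Suc d))"

lemma connection_coeff_rec:
  assumes l: "l \<notin> \<int>\<^sub>\<le>\<^sub>0"
  shows "(of_nat d + of_nat k + 2) * (of_nat d - of_nat k + l) * connection_coeff v l (Suc d) (Suc k) =
    (of_nat d + of_nat k + 1 + v) * ((of_nat d - of_nat k) * connection_coeff v l d (Suc k)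
        + (of_nat d - of_nat k + 2 * l) * connection_coeff v l (Suc d) k)
    - (of_nat d + of_nat k + 2 * v) * (of_nat d - of_nat k + l) * connection_coeff v l d k"
proof -
  define B where "B = pochhammer v d * pochhammer (v - l) k / (fact (Suc k) * pochhammer l (Suc (Suc d)))"
  have nz: "l + of_nat d + 1 \<noteq> 0" "l + of_nat d \<noteq> 0" "pochhammer l d \<noteq> 0" "of_nat k + 1 \<noteq> (0::complex)"
    using nonpos_Ints_add_of_nat_nz[OF l, of "Suc d"] nonpos_Ints_add_of_nat_nz[OF l, of d] l
    by (auto simp: add_ac dest: pochhammer_eq_0_imp_nonpos_Int) (metis of_nat_Suc of_nat_neq_0)
  have B: "connection_coeff v l (Suc d) (Suc k) = B * (v + of_nat d) * (v - l + of_nat k)"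
    "connection_coeff v l d (Suc k) = B * (v - l + of_nat k) * (l + of_nat d + 1)"
    "connection_coeff v l (Suc d) k = B * (of_nat k + 1) * (v + of_nat d)"
    "connection_coeff v l d k = B * (of_nat k + 1) * (l + of_nat d + 1)"
    unfolding B_def connection_coeff_def using nz by (simp_all add: pochhammer_Suc divide_simps add_ac)
  show ?thesis unfolding B by (simp add: algebra_simps)
qed

text \<open>
  Gegenbauer's connection formula. The right-hand side satisfies the recurrence that characterises
  \<open>C\<^sub>m\<^sup>v\<close>: multiplication by \<open>2 x\<close> is carried out with the recurrence for the parameter \<open>l\<close>, after which
  the coefficients are compared. The summands with \<open>2 k > m\<close> vanish.
\<close>
lemma gegenbauer_connection:
  assumes l: "l \<notin> \<int>\<^sub>\<le>\<^sub>0"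
  shows "gegenbauer v m x = (\<Sum>k\<le>m. connection_coeff v l (m - k) k * (of_int (int m - 2 * int k) + l) *
      gegenbauer_int l (int m - 2 * int k) x)"
proof (rule gegenbauer_unique[symmetric])
  let ?f = "\<lambda>m. \<Sum>k\<le>m. connection_coeff v l (m - k) k * (of_int (int m - 2 * int k) + l) * gegenbauer_int l
      (int m - 2 * int k) x"
  have nz: "l + 1 \<noteq> 0" "l \<noteq> 0"
    using nonpos_Ints_add_of_nat_nz[OF l, of 1] nonpos_Ints_add_of_nat_nz[OF l, of 0] by auto
  show "?f 0 = 1" using nz by (simp add: connection_coeff_def gegenbauer_int_def)
  have "?f (Suc 0) = v / (l * (l + 1)) * (1 + l) * (2 * l * x)"
    by (simp add: connection_coeff_def gegenbauer_int_def pochhammer_Suc)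
  then show "?f (Suc 0) = 2 * v * x" using nz by (simp add: add.commute)
  fix m :: nat
  define c where "c k = gegenbauer_int l (int m - 2 * int k) x" for k
  have "2 * x * ?f (Suc m) = (\<Sum>k\<le>Suc m. connection_coeff v l (Suc m - k) k *
      ((of_nat m + 2 - 2 * of_nat k) * gegenbauer_int l (int m + 2 - 2 * int k) x + (of_nat m + 2 * l - 2
          * of_nat k) * c k))"
    unfolding sum_distrib_left
  proof (intro sum.cong refl)
    fix k 
    show "2 * x * (connection_coeff v l (Suc m - k) k * (of_int (int (Suc m) - 2 * int k) + l) *
        gegenbauer_int l (int (Suc m) - 2 * int k) x) =
      connection_coeff v l (Suc m - k) k *
      ((of_nat m + 2 - 2 * of_nat k) * gegenbauer_int l (int m + 2 - 2 * int k) x + (of_nat m + 2 * l - 2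
          * of_nat k) * c k)"
      using arg_cong[OF gegenbauer_int_recurrence[of x "int (Suc m) - 2 * int k" l], of "\<lambda>t.
          connection_coeff v l (Suc m - k) k * t"]
      unfolding c_def
      by (simp add: algebra_simps)
  qed
  also have "\<dots> = (\<Sum>k\<le>Suc m. connection_coeff v l (Suc m - k) k * ((of_nat m + 2 - 2 * of_nat k) *
      gegenbauer_int l (int m + 2 - 2 * int k) x))
       + (\<Sum>k\<le>Suc m. connection_coeff v l (Suc m - k) k * ((of_nat m + 2 * l - 2 * of_nat k) * c k))"
    by (simp add: distrib_left sum.distrib)
  also have "(\<Sum>k\<le>Suc m. connection_coeff v l (Suc m - k) k * ((of_nat m + 2 - 2 * of_nat k) *
      gegenbauer_int l (int m + 2 - 2 * int k) x))
      = connection_coeff v l (Suc m) 0 * (of_nat m + 2) * gegenbauer_int l (int m + 2) x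
        + (\<Sum>k\<le>m. connection_coeff v l (m - k) (Suc k) * ((of_nat m - 2 * of_nat k) * c k))"
    by (subst sum.atMost_Suc_shift) (simp add: c_def algebra_simps)
  also have "(\<Sum>k\<le>Suc m. connection_coeff v l (Suc m - k) k * ((of_nat m + 2 * l - 2 * of_nat k) * c k)) =
      (\<Sum>k\<le>m. connection_coeff v l (Suc (m - k)) k * ((of_nat m + 2 * l - 2 * of_nat k) * c k))"
    by (simp add: Suc_diff_le c_def gegenbauer_int_def)
  also have "connection_coeff v l (Suc m) 0 * (of_nat m + 2) * gegenbauer_int l (int m + 2) x
        + (\<Sum>k\<le>m. connection_coeff v l (m - k) (Suc k) * ((of_nat m - 2 * of_nat k) * c k)) + \<dots> =
      connection_coeff v l (Suc m) 0 * (of_nat m + 2) * gegenbauer_int l (int m + 2) x +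
      (\<Sum>k\<le>m. (connection_coeff v l (m - k) (Suc k) * (of_nat m - 2 * of_nat k)
        + connection_coeff v l (Suc (m - k)) k * (of_nat m + 2 * l - 2 * of_nat k)) * c k)"
    unfolding add.assoc sum.distrib[symmetric] by (simp add: distrib_right mult.assoc)
  finally have 1: "2 * x * ?f (Suc m) = connection_coeff v l (Suc m) 0 * (of_nat m + 2) * gegenbauer_int l
      (int m + 2) x +
      (\<Sum>k\<le>m. (connection_coeff v l (m - k) (Suc k) * (of_nat m - 2 * of_nat k)
        + connection_coeff v l (Suc (m - k)) k * (of_nat m + 2 * l - 2 * of_nat k)) * c k)" .
  have "?f (Suc (Suc m)) = connection_coeff v l (Suc (Suc m)) 0 * (of_nat m + 2 + l) * gegenbauer_int l
      (int m + 2) x +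
      (\<Sum>k\<le>Suc m. connection_coeff v l (Suc m - k) (Suc k) * ((of_nat m - 2 * of_nat k + l) * c k))"
    by (subst sum.atMost_Suc_shift) (simp add: c_def algebra_simps)
  also have "(\<Sum>k\<le>Suc m. connection_coeff v l (Suc m - k) (Suc k) * ((of_nat m - 2 * of_nat k + l) * c k)) =
     (\<Sum>k\<le>m. connection_coeff v l (Suc (m - k)) (Suc k) * ((of_nat m - 2 * of_nat k + l) * c k))"
    by (simp add: Suc_diff_le c_def gegenbauer_int_def)
  finally have 2: "?f (Suc (Suc m)) = connection_coeff v l (Suc (Suc m)) 0 * (of_nat m + 2 + l) *
      gegenbauer_int l (int m + 2) x +
     (\<Sum>k\<le>m. connection_coeff v l (Suc (m - k)) (Suc k) * ((of_nat m - 2 * of_nat k + l) * c k))" .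
  have 3: "connection_coeff v l (Suc (Suc m)) 0 * (of_nat m + 2 + l) = connection_coeff v l (Suc m) 0 *
      (of_nat m + 1 + v)"
    using nonpos_Ints_add_of_nat_nz[OF l, of "Suc (Suc m)"] l
    by (auto simp: connection_coeff_def pochhammer_Suc divide_simps add_ac dest: pochhammer_eq_0_imp_nonpos_Int)
  have 4: "(\<Sum>k\<le>m. (of_nat m + 2) * (connection_coeff v l (Suc (m - k)) (Suc k) * ((of_nat m - 2 * of_nat k
      + l) * c k))) =
     (\<Sum>k\<le>m. (of_nat m + 1 + v) * ((connection_coeff v l (m - k) (Suc k) * (of_nat m - 2 * of_nat k)
        + connection_coeff v l (Suc (m - k)) k * (of_nat m + 2 * l - 2 * of_nat k)) * c k)
        - (of_nat m + 2 * v) * (connection_coeff v l (m - k) k * (of_nat m - 2 * of_nat k + l) * c k))"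
  proof (intro sum.cong refl)
    fix k assume "k \<in> {..m}"
    then obtain d where m: "m = d + k" by (metis atMost_iff le_add_diff_inverse2)
    show "(of_nat m + 2) * (connection_coeff v l (Suc (m - k)) (Suc k) * ((of_nat m - 2 * of_nat k + l) *
        c k)) =
      (of_nat m + 1 + v) * ((connection_coeff v l (m - k) (Suc k) * (of_nat m - 2 * of_nat k)
        + connection_coeff v l (Suc (m - k)) k * (of_nat m + 2 * l - 2 * of_nat k)) * c k)
        - (of_nat m + 2 * v) * (connection_coeff v l (m - k) k * (of_nat m - 2 * of_nat k + l) * c k)"
      using arg_cong[OF connection_coeff_rec[OF l, of d k v], of "\<lambda>t. t * c k"] unfolding m
      by (simp add: algebra_simps)
  qed
  have 5: "?f m = (\<Sum>k\<le>m. connection_coeff v l (m - k) k * (of_nat m - 2 * of_nat k + l) * c k)"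
    by (simp add: c_def)
  define S0 where "S0 = (\<Sum>k\<le>m. connection_coeff v l (m - k) k * (of_nat m - 2 * of_nat k + l) * c k)"
  define S1 where "S1 = (\<Sum>k\<le>m. (connection_coeff v l (m - k) (Suc k) * (of_nat m - 2 * of_nat k)
        + connection_coeff v l (Suc (m - k)) k * (of_nat m + 2 * l - 2 * of_nat k)) * c k)"
  define S2 where "S2 = (\<Sum>k\<le>m. connection_coeff v l (Suc (m - k)) (Suc k) * ((of_nat m - 2 * of_nat k + l)
      * c k))"
  have "(of_nat m + 2) * S2 = (of_nat m + 1 + v) * S1 - (of_nat m + 2 * v) * S0"
    unfolding S0_def S1_def S2_def by (simp only: sum_distrib_left 4 sum_subtractf)
  then have "(of_nat m + 2) * ?f (Suc (Suc m)) =
      (of_nat m + 1 + v) * (2 * x * ?f (Suc m)) - (of_nat m + 2 * v) * ?f m"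
    unfolding 1 2 3 5 S0_def[symmetric] S1_def[symmetric] S2_def[symmetric]
    by (simp add: algebra_simps)
  then show "(of_nat m + 2) * ?f (Suc (Suc m)) = 2 * x * (of_nat m + 1 + v) * ?f (Suc m) - (of_nat m + 2 *
      v) * ?f m"
    by (simp only: mult.assoc mult.left_commute)
qed

section \<open>The inverse Joukowski map and confocal ellipses\<close>

text \<open>
  For \<open>z\<close> off \<open>(-\<infinity>, 1]\<close> this is the inverse \<open>p = z - (z\<^sup>2 - 1)\<^sup>1\<^sup>/\<^sup>2\<close> of the Joukowski map, i.e. the
  solution of \<open>p + 1/p = 2 z\<close> with \<open>\<bar>p\<bar> < 1\<close>. In the form used here, \<open>2/p\<close> is the square of a number with
  positive real part, so \<open>p\<close> is seen to avoid the cut of the principal powers.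
\<close>
definition joukowski :: "complex \<Rightarrow> complex" where
  "joukowski z = 2 / (csqrt (z + 1) + csqrt (z - 1)) ^ 2"

text \<open>
  Explicit numbers with product \<open>1\<close> and sum \<open>2 z\<close>. By the parallelogram law the sum of their absolute
  values is the sum of the focal distances of \<open>z\<close>; hence confocal ellipses correspond to circles.
\<close>
lemma joukowski_aux:
  fixes z :: complex
  defines "u \<equiv> csqrt (z + 1)" and "v \<equiv> csqrt (z - 1)"
  shows "(u + v) ^ 2 / 2 * ((u - v) ^ 2 / 2) = 1"
    and "(u + v) ^ 2 / 2 + (u - v) ^ 2 / 2 = 2 * z"
    and "norm ((u + v) ^ 2 / 2) + norm ((u - v) ^ 2 / 2) = dist z 1 + dist z (- 1)"
proof -
  have uv: "u ^ 2 = z + 1" "v ^ 2 = z - 1" by (simp_all add: u_def v_def)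
  have "(u + v) ^ 2 / 2 * ((u - v) ^ 2 / 2) = (u ^ 2 - v ^ 2) ^ 2 / 4"
    by (simp add: power2_eq_square field_simps)
  then show "(u + v) ^ 2 / 2 * ((u - v) ^ 2 / 2) = 1" by (simp add: uv)
  have "(u + v) ^ 2 / 2 + (u - v) ^ 2 / 2 = u ^ 2 + v ^ 2"
    by (simp add: power2_eq_square field_simps)
  then show "(u + v) ^ 2 / 2 + (u - v) ^ 2 / 2 = 2 * z" by (simp add: uv)
  have "norm ((u + v) ^ 2 / 2) + norm ((u - v) ^ 2 / 2) = norm u ^ 2 + norm v ^ 2"
    unfolding norm_divide norm_power cmod_power2 by (simp add: power2_eq_square field_simps)
  also have "\<dots> = norm (z + 1) + norm (z - 1)"
    by (simp flip: norm_power add: uv)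
  finally show "norm ((u + v) ^ 2 / 2) + norm ((u - v) ^ 2 / 2) = dist z 1 + dist z (- 1)"
    by (simp add: dist_norm)
qed

lemma joukowski_param_exists:
  fixes x :: complex
  obtains r r' where "r * r' = 1" "r + r' = 2 * x" "norm r \<ge> 1"
    "norm r + 1 / norm r = dist x 1 + dist x (- 1)"
proof -
  note intro = that
  have *: thesis if r: "r * r' = 1" "r + r' = 2 * x" "norm r + norm r' = dist x 1 + dist x (- 1)" "norm r
      \<ge> 1" for r r'
  proof (rule intro[OF r(1,2,4)])
    have "r' = 1 / r" using r(1) by (metis nonzero_mult_div_cancel_left mult_zero_left zero_neq_one)
    then show "norm r + 1 / norm r = dist x 1 + dist x (- 1)" using r(3) by (simp add: norm_divide)
  qed
  let ?a = "(csqrt (x + 1) + csqrt (x - 1)) ^ 2 / 2" and ?b = "(csqrt (x + 1) - csqrt (x - 1)) ^ 2 / 2"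
  note j = joukowski_aux[of x]
  have "norm ?a * norm ?b = 1" using arg_cong[OF j(1), of norm] by (simp only: norm_mult norm_one)
  then consider "norm ?a \<ge> 1" | "norm ?b \<ge> 1"
    by (smt (verit) mult_le_one norm_ge_zero mult_strict_mono mult.right_neutral)
  then show thesis
  proof cases
    case 1
    show ?thesis by (rule *[OF j 1])
  next
    case 2
    show ?thesis by (rule *[of ?b ?a, OF _ _ _ 2]) (use j in \<open>simp_all only: mult.commute add.commute\<close>)
  qed
qed

lemma not_in_slit_iff:
  "z \<notin> complex_of_real ` {..1} \<longleftrightarrow> Im z \<noteq> 0 \<or> Re z > 1"
  by (force simp: complex_eq_iff image_iff)

lemma slit_nonpos_Reals:
  assumes "z \<notin> complex_of_real ` {..1}"
  shows "z \<notin> \<real>\<^sub>\<le>\<^sub>0" "z - 1 \<notin> \<real>\<^sub>\<le>\<^sub>0" "z + 1 \<notin> \<real>\<^sub>\<le>\<^sub>0"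
  using assms unfolding not_in_slit_iff complex_nonpos_Reals_iff by auto

lemma Re_csqrt_pos: "z \<notin> \<real>\<^sub>\<le>\<^sub>0 \<Longrightarrow> Re (csqrt z) > 0"
proof (rule ccontr)
  assume z: "z \<notin> \<real>\<^sub>\<le>\<^sub>0" and "\<not> Re (csqrt z) > 0"
  then have "Re (csqrt z) = 0" using csqrt_principal[of z] by auto
  then have "Im (csqrt z ^ 2) = 0" "Re (csqrt z ^ 2) \<le> 0" by (auto simp: power2_eq_square)
  with z show False by (simp add: complex_nonpos_Reals_iff)
qed

lemma square_not_nonpos_Reals: "Re w > 0 \<Longrightarrow> w ^ 2 \<notin> \<real>\<^sub>\<le>\<^sub>0"
  by (auto simp: complex_nonpos_Reals_iff power2_eq_square mult_le_0_iff)

lemma joukowski: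
  assumes z: "z \<notin> complex_of_real ` {..1}"
  shows "joukowski z \<noteq> 0" "joukowski z \<notin> \<real>\<^sub>\<le>\<^sub>0" "norm (joukowski z) < 1"
    and "1 + joukowski z ^ 2 = 2 * z * joukowski z"
    and "norm (joukowski z) + 1 / norm (joukowski z) = dist z 1 + dist z (- 1)"
proof -
  define u v where "u = csqrt (z + 1)" and "v = csqrt (z - 1)"
  note j = joukowski_aux[of z, folded u_def v_def]
  have re: "Re u > 0" "Re v > 0"
    unfolding u_def v_def by (rule Re_csqrt_pos, rule slit_nonpos_Reals[OF z])+
  have w: "(u + v) ^ 2 \<notin> \<real>\<^sub>\<le>\<^sub>0" using re by (intro square_not_nonpos_Reals) auto
  then have nz: "u + v \<noteq> 0" by auto
  have J: "joukowski z = 2 / (u + v) ^ 2" by (simp add: joukowski_def u_def v_def)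
  have J': "joukowski z = (u - v) ^ 2 / 2"
    unfolding J using j(1) nz by (simp add: field_simps)
  show "joukowski z \<noteq> 0" using nz by (simp add: J)
  show "joukowski z \<notin> \<real>\<^sub>\<le>\<^sub>0"
  proof
    assume "joukowski z \<in> \<real>\<^sub>\<le>\<^sub>0"
    then have "2 / joukowski z \<in> \<real>\<^sub>\<le>\<^sub>0" by (intro nonpos_Reals_divide_I1) auto
    then show False using w by (simp add: J)
  qed
  have uv: "u ^ 2 = z + 1" "v ^ 2 = z - 1" by (simp_all add: u_def v_def)
  have "2 * (Re u * Im u) = Im z" "2 * (Re v * Im v) = Im z"
    using arg_cong[OF uv(1), of Im] arg_cong[OF uv(2), of Im]
    by (simp_all add: power2_eq_square mult.commute)
  then have "(2 * (Re u * Im u)) * (2 * (Re v * Im v)) = Im z * Im z" by simp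
  also have "(2 * (Re u * Im u)) * (2 * (Re v * Im v)) = (4 * (Re u * Re v)) * (Im u * Im v)"
    by (simp add: mult_ac)
  finally have "(4 * (Re u * Re v)) * (Im u * Im v) = Im z * Im z" .
  then have "Im u * Im v \<ge> 0"
    using mult_pos_pos[OF re] zero_le_square[of "Im z"]
      zero_le_mult_iff[of "4 * (Re u * Re v)" "Im u * Im v"] by simp
  then have *: "norm (u - v) ^ 2 < norm (u + v) ^ 2"
    unfolding cmod_power2 using mult_pos_pos[OF re] by (simp add: power2_eq_square algebra_simps)
  have "norm ((u + v) ^ 2 / 2) * norm (joukowski z) = 1"
    using arg_cong[OF j(1), of norm] unfolding J' by (simp only: norm_mult norm_one)
  moreover have "norm (joukowski z) < norm ((u + v) ^ 2 / 2)"
    unfolding J' using * by (simp add: norm_divide norm_power)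
  ultimately show "norm (joukowski z) < 1"
    by (smt (verit) mult_le_cancel_left1 norm_ge_zero)
  show "1 + joukowski z ^ 2 = 2 * z * joukowski z"
    unfolding j(2)[symmetric] J'[symmetric] distrib_right using nz by (simp add: J power2_eq_square)
  show "norm (joukowski z) + 1 / norm (joukowski z) = dist z 1 + dist z (- 1)"
    using j(3) unfolding J'[symmetric] by (simp add: J norm_divide)
qed

lemma joukowski_real:
  assumes "t > 1"
  obtains p where "joukowski (complex_of_real t) = complex_of_real p" "0 < p" "p < 1" "p \<le> 2 / (t + 1)"
proof
  have nn: "sqrt (t + 1) > 0" "sqrt (t - 1) > 0" using assms by auto
  have "csqrt (of_real t + 1) = of_real (sqrt (t + 1))" "csqrt (of_real t - 1) = of_real (sqrt (t - 1))"
    using assms csqrt_of_real_nonneg[of "of_real (t + 1)"] csqrt_of_real_nonneg[of "of_real (t - 1)"] by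
        simp_all
  then show "joukowski (complex_of_real t) = complex_of_real (2 / (sqrt (t + 1) + sqrt (t - 1)) ^ 2)"
    unfolding joukowski_def by simp
  show "2 / (sqrt (t + 1) + sqrt (t - 1)) ^ 2 > 0"
    using add_pos_pos[OF nn] by simp
  have "t + 1 = sqrt (t + 1) ^ 2" using assms by simp
  also have "\<dots> \<le> (sqrt (t + 1) + sqrt (t - 1)) ^ 2"
    using nn by (intro power_mono) auto
  finally show *: "2 / (sqrt (t + 1) + sqrt (t - 1)) ^ 2 \<le> 2 / (t + 1)"
    using assms by (intro divide_left_mono mult_pos_pos zero_less_power add_pos_pos nn) auto
  also have "\<dots> < 1" using assms by simp
  finally show "2 / (sqrt (t + 1) + sqrt (t - 1)) ^ 2 < 1" .
qed

lemma holomorphic_joukowski: "joukowski holomorphic_on (- complex_of_real ` {..1})"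
proof -
  have "(csqrt (z + 1) + csqrt (z - 1)) ^ 2 \<noteq> 0" if "z \<in> - complex_of_real ` {..1}" for z
    using joukowski(1)[of z] that by (auto simp: joukowski_def)
  then show ?thesis unfolding joukowski_def
    by (intro holomorphic_intros) (use slit_nonpos_Reals in auto)
qed

lemma open_slit: "open (- complex_of_real ` {..1})"
proof -
  have "complex_of_real ` {..1} = {z. Im z = 0 \<and> Re z \<le> 1}"
    by (force simp: complex_eq_iff image_iff)
  also have "closed \<dots>"
    by (intro closed_Collect_conj closed_Collect_eq closed_Collect_le continuous_intros)
  finally show ?thesis by auto
qed

lemma open_exterior: "open ({z. norm z > 1} - complex_of_real ` {..1})"
  using open_Int[OF open_Collect_less[of "\<lambda>_. 1" "norm :: complex \<Rightarrow> real"] open_slit]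
  by (simp add: Diff_eq continuous_intros)

lemma connected_slit: "connected (- complex_of_real ` {..1})"
proof (rule starlike_imp_connected)
  have "closed_segment 2 z \<subseteq> - complex_of_real ` {..1}" if "z \<in> - complex_of_real ` {..1}" for z
  proof
    fix w assume "w \<in> closed_segment 2 z"
    then obtain u where u: "0 \<le> u" "u \<le> 1" "w = (1 - u) *\<^sub>R 2 + u *\<^sub>R z"
      unfolding closed_segment_def by blast
    have w: "Im w = u * Im z" "Re w = 2 * (1 - u) + u * Re z" by (simp_all add: u(3))
    have "Im z \<noteq> 0 \<or> Re z > 1" using that not_in_slit_iff by auto
    then have "Im w \<noteq> 0 \<or> Re w > 1"
    proof
      assume "Re z > 1"
      then have "u * (Re z - 1) \<ge> 0" "u = 1 \<Longrightarrow> Re w > 1" using u w by auto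
      then show ?thesis using u w by (cases "u = 1") (auto simp: algebra_simps)
    qed (cases "u = 0", use u w in auto)
    then show "w \<in> - complex_of_real ` {..1}" using not_in_slit_iff by auto
  qed
  moreover have "2 \<in> - complex_of_real ` {..1}" using not_in_slit_iff[of 2] by auto
  ultimately show "starlike (- complex_of_real ` {..1})" unfolding starlike_def by blast
qed

lemma connected_exterior: "connected ({z. norm z > 1} - complex_of_real ` {..1})"
proof -
  have "exp ` {w. Re w > 0 \<and> - pi < Im w \<and> Im w < pi} = {z. norm z > 1} - complex_of_real ` {..1}"
  proof (intro equalityI subsetI)
    fix z assume "z \<in> exp ` {w. Re w > 0 \<and> - pi < Im w \<and> Im w < pi}"
    then obtain w where w: "z = exp w" "Re w > 0" "- pi < Im w" "Im w < pi" by auto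
    have "Im (Ln z) < pi" "z \<noteq> 0" using w by simp_all
    then have "z \<notin> \<real>\<^sub>\<le>\<^sub>0"
      using Im_Ln_eq_pi[of z] by (auto simp: complex_nonpos_Reals_iff complex_eq_iff order.order_iff_strict)
    moreover have "norm z > 1" using w by simp
    ultimately show "z \<in> {z. norm z > 1} - complex_of_real ` {..1}"
      by (auto simp: image_iff)
  next
    fix z assume z: "z \<in> {z. norm z > 1} - complex_of_real ` {..1}"
    then have "z \<notin> \<real>\<^sub>\<le>\<^sub>0" "z \<noteq> 0" using slit_nonpos_Reals by auto
    then have "Im (Ln z) < pi"
      using Im_Ln_eq_pi[of z] Im_Ln_le_pi[of z] by (auto simp: complex_nonpos_Reals_iff order.order_iff_strict)
    moreover have "Re (Ln z) > 0" using z \<open>z \<noteq> 0\<close> by (simp add: Re_Ln)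
    ultimately show "z \<in> exp ` {w. Re w > 0 \<and> - pi < Im w \<and> Im w < pi}"
      using \<open>z \<noteq> 0\<close> mpi_less_Im_Ln by (intro image_eqI[of _ _ "Ln z"]) auto
  qed
  moreover have "convex {w. Re w > 0 \<and> - pi < Im w \<and> Im w < pi}"
  proof -
    have "{w. Re w > 0 \<and> - pi < Im w \<and> Im w < pi} = {w. Re w > 0} \<inter> ({w. Im w > - pi} \<inter> {w. Im w < pi})"
      by auto
    then show ?thesis
      by (simp add: convex_Int convex_halfspace_Re_gt convex_halfspace_Im_gt convex_halfspace_Im_lt)
  qed
  then have "connected (exp ` {w. Re w > 0 \<and> - pi < Im w \<and> Im w < pi})"
    by (intro connected_continuous_image convex_connected continuous_intros)
  ultimately show ?thesis by simp
qed

text \<open>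
  For \<open>x\<close> inside the ellipse through \<open>z\<close> the generating function of the Gegenbauer polynomials at \<open>x\<close>
  converges at the point \<open>joukowski z\<close>.
\<close>
lemma ellipse_interior_param:
  assumes z: "z \<in> confocal_ellipse s" "z \<notin> complex_of_real ` {..1}"
    and x: "x \<in> confocal_ellipse_interior s"
  obtains r r' where "r * r' = 1" "r + r' = 2 * x" "norm r \<ge> 1"
    "norm (r * joukowski z) < 1" "norm (r' * joukowski z) < 1"
proof -
  obtain r r' where r: "r * r' = 1" "r + r' = 2 * x" "norm r \<ge> 1"
    "norm r + 1 / norm r = dist x 1 + dist x (- 1)"
    by (rule joukowski_param_exists)
  define a p where "a = norm r" and "p = norm (joukowski z)"
  have p: "0 < p" "p < 1" "p + 1 / p = s"
    using joukowski[OF z(2)] z(1) by (auto simp: p_def confocal_ellipse_def)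
  have a: "a \<ge> 1" "a + 1 / a < s" using r x by (auto simp: a_def confocal_ellipse_interior_def)
  have "a * p < 1"
  proof (rule ccontr)
    assume "\<not> a * p < 1"
    then have "(a - 1 / p) * (1 - p / a) \<ge> 0"
      using p a by (intro mult_nonneg_nonneg) (auto simp: field_simps)
    also have "(a - 1 / p) * (1 - p / a) = (a + 1 / a) - (p + 1 / p)"
      using p(1) a(1) by (simp add: left_diff_distrib right_diff_distrib) (simp add: diff_divide_distrib)
    finally show False using p a by simp
  qed
  moreover have "norm r' \<le> norm r"
  proof -
    have "norm r * norm r' = 1" using r(1) by (metis norm_mult norm_one)
    moreover have "1 * norm r' \<le> norm r * norm r'" using r(3) by (intro mult_right_mono) auto
    ultimately show ?thesis using r(3) by linarith
  qed
  then have "norm (r' * joukowski z) \<le> a * p"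
    by (simp add: norm_mult a_def p_def mult_right_mono)
  ultimately show thesis
    using that[OF r(1-3)] by (simp add: norm_mult a_def p_def)
qed

lemma open_ellipse_interior: "open (confocal_ellipse_interior s)"
  unfolding confocal_ellipse_interior_def by (intro open_Collect_less continuous_intros)

lemma convex_ellipse_interior: "convex (confocal_ellipse_interior s)"
proof (rule convexI)
  fix a b :: complex and u v :: real
  assume ab: "a \<in> confocal_ellipse_interior s" "b \<in> confocal_ellipse_interior s"
    and uv: "0 \<le> u" "0 \<le> v" "u + v = 1"
  have *: "dist (u *\<^sub>R a + v *\<^sub>R b) c \<le> u * dist a c + v * dist b c" for c
  proof -
    have "u *\<^sub>R a + v *\<^sub>R b - c = u *\<^sub>R (a - c) + v *\<^sub>R (b - c)"
      using uv(3) by (simp add: algebra_simps flip: scaleR_left.add)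
    then show ?thesis
      using norm_triangle_ineq[of "u *\<^sub>R (a - c)" "v *\<^sub>R (b - c)"] uv by (simp add: dist_norm)
  qed
  have "u * (dist a 1 + dist a (- 1)) + v * (dist b 1 + dist b (- 1)) < s"
    using ab uv unfolding confocal_ellipse_interior_def mem_Collect_eq
    by (rule_tac convex_bound_lt) auto
  with *[of 1] *[of "- 1"] show "u *\<^sub>R a + v *\<^sub>R b \<in> confocal_ellipse_interior s"
    by (simp add: confocal_ellipse_interior_def distrib_left)
qed

lemma unit_interval_subset_interior:
  assumes "s > 2"
  shows "complex_of_real ` {-1<..<1} \<subseteq> confocal_ellipse_interior s"
proof
  fix t assume "t \<in> complex_of_real ` {-1<..<1}"
  then obtain u where u: "t = of_real u" "-1 < u" "u < 1" by auto
  have "dist t 1 = norm (complex_of_real (u - 1))" "dist t (-1) = norm (complex_of_real (u + 1))"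
    unfolding u(1) dist_norm by simp_all
  then show "t \<in> confocal_ellipse_interior s"
    using u assms unfolding norm_of_real by (auto simp: confocal_ellipse_interior_def)
qed

lemma islimpt_unit_interval: "0 islimpt complex_of_real ` {-1<..<1}"
  unfolding islimpt_approachable
proof (intro allI impI)
  fix e :: real assume "e > 0"
  then show "\<exists>x'\<in>complex_of_real ` {- 1<..<1}. x' \<noteq> 0 \<and> dist x' 0 < e"
    by (intro bexI[of _ "of_real (min (e / 2) (1 / 2))"]) (auto simp: norm_of_real min_def)
qed

text \<open>
  The factorisation \<open>1 - 2 t p + p\<^sup>2 = 2 p (z - t)\<close> passes to principal powers for real \<open>t\<close> in \<open>(-1, 1)\<close>,
  because \<open>Im p\<close> and \<open>Im (z - t)\<close> have opposite signs, or else \<open>p\<close> and \<open>z - t\<close> are both positive; so the sum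
  of the principal arguments stays between \<open>-\<pi>\<close> and \<open>\<pi>\<close>.
\<close>
lemma powr_joukowski_diff:
  assumes z: "z \<notin> complex_of_real ` {..1}" and t: "-1 < t" "t < 1"
  shows "(z - of_real t) powr a = (2 * joukowski z) powr (- a) *
     (1 - 2 * of_real t * joukowski z + joukowski z ^ 2) powr a"
proof -
  define p where "p = joukowski z"
  note J = joukowski[OF z, folded p_def]
  define b where "b = z - of_real t"
  have b: "b \<noteq> 0" "2 * p \<noteq> 0" using z t J(1) by (auto simp: b_def)
  have *: "2 * z = p + 1 / p" using J(4) J(1) by (simp add: field_simps power2_eq_square)
  have "2 * Im z = Im (2 * z)" by simp
  also have "\<dots> = Im p + Im (1 / p)" unfolding * by (rule plus_complex.sel)
  also have "Im (1 / p) = - Im p / norm p ^ 2"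
    by (simp add: divide_inverse cmod_power2)
  finally have im: "2 * Im z = Im p * (1 - 1 / norm p ^ 2)" by (simp add: algebra_simps)
  define k where "k = 1 - 1 / norm p ^ 2"
  have "k < 0" using J(1,3) by (simp add: k_def power_less_one_iff)
  moreover from this have "Im p = 2 * Im z / k" using im by (simp add: k_def[symmetric])
  ultimately have sg: "Im z > 0 \<Longrightarrow> Im p < 0" "Im z < 0 \<Longrightarrow> Im p > 0" "Im z = 0 \<Longrightarrow> Im p = 0"
    by (simp_all add: divide_less_0_iff zero_less_divide_iff)
  have neg: "Im (Ln w) < 0 \<and> Im (Ln w) > - pi" if "Im w < 0" for w
  proof -
    have "w \<noteq> 0" using that by auto
    then show ?thesis using that Im_Ln_pos_le[of w] Im_Ln_le_pi[of w] mpi_less_Im_Ln[of w] by linarith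
  qed
  have "- pi < Im (Ln (2 * p)) + Im (Ln b) \<and> Im (Ln (2 * p)) + Im (Ln b) \<le> pi"
  proof -
    consider "Im z > 0" | "Im z < 0" | "Im z = 0" "Re z > 1" using z not_in_slit_iff by force
    then show ?thesis
    proof cases
      case 1
      then show ?thesis using neg[of "2 * p"] Im_Ln_pos_lt_imp[of b] sg by (auto simp: b_def)
    next
      case 2
      then show ?thesis using neg[of b] Im_Ln_pos_lt_imp[of "2 * p"] sg by (auto simp: b_def)
    next
      case 3
      then have "Im (Ln b) = 0" using t b by (simp add: Im_Ln_eq_0 b_def)
      moreover have "Im (Ln (2 * p)) = 0"
        using 3 sg J(2) b by (auto simp: Im_Ln_eq_0 complex_nonpos_Reals_iff)
      ultimately show ?thesis by simp
    qed
  qed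
  then have "Ln (2 * p * b) = Ln (2 * p) + Ln b" using b by (intro Ln_times_simple) auto
  moreover have "1 - 2 * of_real t * p + p ^ 2 = 2 * p * b"
    using J(4) by (simp add: b_def algebra_simps)
  ultimately show ?thesis
    unfolding p_def[symmetric] b_def[symmetric] using b
    by (simp add: powr_def distrib_left flip: exp_add)
qed

section \<open>The Ferrers function in terms of Gegenbauer polynomials\<close>

lemma subexponential_hyp2F1:
  fixes a b c :: complex
  assumes "c \<notin> \<int>\<^sub>\<le>\<^sub>0"
  shows "subexponential (\<lambda>k. pochhammer a k * pochhammer b k / (fact k * pochhammer c k))"
  using subexponential_mult[OF subexponential_pochhammer_ratio[OF assms, of a]
      subexponential_pochhammer_fact[of b]]
  by (simp add: mult_ac)

lemma hyp2F1_reg_sums: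
  assumes "c \<notin> \<int>\<^sub>\<le>\<^sub>0" "norm w < 1"
  shows "(\<lambda>k. rGamma c * (pochhammer a k * pochhammer b k / (fact k * pochhammer c k)) * w ^ k) sums
      hyp2F1_reg a b c w"
proof -
  have nz: "pochhammer c k \<noteq> 0" for k using assms(1) by (auto dest: pochhammer_eq_0_imp_nonpos_Int)
  have *: "pochhammer a k * pochhammer b k * rGamma (c + of_nat k) / fact k * w ^ k =
      rGamma c * (pochhammer a k * pochhammer b k / (fact k * pochhammer c k)) * w ^ k" for k
    using nz[of k] pochhammer_rGamma[of c k] by (simp add: field_simps)
  have "summable (\<lambda>k. rGamma c * (pochhammer a k * pochhammer b k / (fact k * pochhammer c k)) * w ^ k)"
    using summable_subexponential[OF subexponential_cmult[OF subexponential_hyp2F1[OF assms(1)]] assms(2)]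
    by (rule summable_norm_cancel)
  then show ?thesis unfolding hyp2F1_reg_def * by (rule summable_sums)
qed

lemma hyp2F1_reg_holomorphic:
  assumes c: "c \<notin> \<int>\<^sub>\<le>\<^sub>0"
  shows "hyp2F1_reg a b c holomorphic_on ball 0 1"
proof (rule power_series_holomorphic)
  fix w :: complex assume "w \<in> ball 0 1"
  then show "(\<lambda>k. rGamma c * (pochhammer a k * pochhammer b k / (fact k * pochhammer c k)) * (w - 0) ^ k)
      sums hyp2F1_reg a b c w"
    using hyp2F1_reg_sums[OF c] by simp
qed

text \<open>
  A contiguous relation, proved by comparing coefficients. In the degree \<open>n\<close> it is the three-term
  recurrence of the Ferrers functions.
\<close>
lemma hyp2F1_reg_contiguous:
  assumes l: "l + 1 / 2 \<notin> \<int>\<^sub>\<le>\<^sub>0" and w: "norm w < 1"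
  shows "(n + 2 * l) * hyp2F1_reg (- n - l - 1 / 2) (n + l + 3 / 2) (l + 1 / 2) w =
     2 * (n + l) * (1 - 2 * w) * hyp2F1_reg (- n - l + 1 / 2) (n + l + 1 / 2) (l + 1 / 2) w -
     n * hyp2F1_reg (- n - l + 3 / 2) (n + l - 1 / 2) (l + 1 / 2) w"
proof -
  define c where "c = l + 1 / 2"
  define a where "a = - n - l + 1 / 2"
  define b where "b = n + l + 1 / 2"
  define C where "C a b k = rGamma c * (pochhammer a k * pochhammer b k / (fact k * pochhammer c k))" for a b k
  have c: "c \<notin> \<int>\<^sub>\<le>\<^sub>0" using l by (simp add: c_def)
  have nz: "pochhammer c k \<noteq> 0" for k using c by (auto dest: pochhammer_eq_0_imp_nonpos_Int)
  note S = hyp2F1_reg_sums[OF c w, folded C_def]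
  have p3: "pochhammer x (Suc (Suc k)) = x * pochhammer (x + 1) k * (x + 1 + of_nat k)" for x :: complex and k
    by (simp only: pochhammer_rec[of x "Suc k"] pochhammer_Suc[of "x + 1" k] mult.assoc)
  have p2: "pochhammer (x - 1) (Suc (Suc k)) = (x - 1) * x * pochhammer (x + 1) k" for x :: complex and k
    by (simp add: pochhammer_rec)
  have p4: "pochhammer (x + 1) (Suc (Suc k)) = pochhammer (x + 1) k * (x + 1 + of_nat k) * (x + 2 + of_nat
      k)" for x :: complex and k
    by (simp add: pochhammer_rec' add_ac mult_ac)
  have rec: "(n + 2 * l) * C (a - 1) (b + 1) (Suc k) = 2 * (n + l) * (C a b (Suc k) - 2 * C a b k) - n * C
      (a + 1) (b - 1) (Suc k)" for k
  proof (cases k)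
    case 0
    have "c \<noteq> 0" using c by auto
    then show ?thesis 
      by (simp add: C_def 0 a_def b_def c_def[symmetric] divide_simps) (simp add: algebra_simps c_def)
  next
    case (Suc k)
    define B where "B = rGamma c * pochhammer (a + 1) k * pochhammer (b + 1) k / (fact (Suc (Suc k)) *
        pochhammer c (Suc (Suc k)))"
    have nz': "c + of_nat k + 1 \<noteq> 0" "of_nat k + 2 \<noteq> (0::complex)" "pochhammer c (Suc k) \<noteq> 0"
      using nz[of "Suc (Suc k)"] nz[of "Suc k"] fact_nonzero[of "Suc (Suc k)", where 'a = complex]
      by (auto simp: pochhammer_rec' add_ac)
    have "C (a - 1) (b + 1) (Suc (Suc k)) = B * ((a - 1) * a) * ((b + 1 + of_nat k) * (b + 2 + of_nat k))"
      unfolding C_def B_def p2 p4 by simp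
    moreover have "C (a + 1) (b - 1) (Suc (Suc k)) = B * ((a + 1 + of_nat k) * (a + 2 + of_nat k)) * ((b -
        1) * b)"
      unfolding C_def B_def p2 p4 by simp
    moreover have "C a b (Suc (Suc k)) = B * (a * (a + 1 + of_nat k)) * (b * (b + 1 + of_nat k))"
      unfolding C_def B_def p3 by simp
    moreover have "C a b (Suc k) = B * a * b * ((of_nat k + 2) * (c + of_nat k + 1))"
      unfolding C_def B_def pochhammer_rec[of a] pochhammer_rec[of b] pochhammer_rec'[of c "Suc k"]
          fact_Suc[of "Suc k"]
      using nz' by (simp add: divide_simps del: fact_Suc) (simp add: algebra_simps)
    ultimately show ?thesis unfolding Suc
      by (simp only: a_def b_def c_def) (simp add: field_simps)
  qed
  have "C x y 0 = rGamma c" for x y by (simp add: C_def)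
  then have rec0: "(n + 2 * l) * C (a - 1) (b + 1) 0 = 2 * (n + l) * C a b 0 - n * C (a + 1) (b - 1) 0"
    by (simp add: algebra_simps)
  define F where "F x y = hyp2F1_reg x y c w" for x y
  have S1: "(\<lambda>k. C x y (Suc k) * w ^ Suc k) sums (F x y - C x y 0)" for x y
    using S[of x y] sums_Suc_iff[of "\<lambda>k. C x y k * w ^ k" "F x y - C x y 0"] by (simp add: F_def)
  have S2: "(\<lambda>k. C x y k * w ^ Suc k) sums (w * F x y)" for x y
    using sums_mult[OF S[of x y], of w] by (simp add: mult_ac F_def)
  have "(\<lambda>k. 2 * (n + l) * (C a b (Suc k) * w ^ Suc k - 2 * (C a b k * w ^ Suc k)) - n * (C (a + 1) (b -
      1) (Suc k) * w ^ Suc k))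
      sums (2 * (n + l) * ((F a b - C a b 0) - 2 * (w * F a b)) - n * (F (a + 1) (b - 1) - C (a + 1) (b -
          1) 0))"
    by (intro sums_diff sums_mult S1 S2)
  moreover have "2 * (n + l) * (C a b (Suc k) * w ^ Suc k - 2 * (C a b k * w ^ Suc k)) - n * (C (a + 1) (b
      - 1) (Suc k) * w ^ Suc k)
      = (n + 2 * l) * (C (a - 1) (b + 1) (Suc k) * w ^ Suc k)" for k
    using arg_cong[OF rec[of k], of "\<lambda>t. t * w ^ Suc k"] by (simp add: algebra_simps)
  ultimately have "(n + 2 * l) * (F (a - 1) (b + 1) - C (a - 1) (b + 1) 0) =
     2 * (n + l) * ((F a b - C a b 0) - 2 * (w * F a b)) - n * (F (a + 1) (b - 1) - C (a + 1) (b - 1) 0)"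
    using sums_mult[OF S1[of "a - 1" "b + 1"], of "n + 2 * l"] sums_unique2 by simp
  then have "(n + 2 * l) * F (a - 1) (b + 1) = 2 * (n + l) * (1 - 2 * w) * F a b - n * F (a + 1) (b - 1)"
    using rec0 by (simp add: algebra_simps)
  moreover have eq: "a - 1 = - n - l - 1 / 2" "a + 1 = - n - l + 3 / 2" "b - 1 = n + l - 1 / 2" "b + 1 = n
      + l + 3 / 2"
    by (simp_all add: a_def b_def)
  ultimately show ?thesis
    unfolding eq unfolding F_def a_def b_def c_def by simp
qed

text \<open>
  Induction on \<open>n\<close> by the contiguous relation turns the Gauss series of the Ferrers function into
  \<open>(1 - w)\<^sup>l\<^sup>-\<^sup>1\<^sup>/\<^sup>2\<close> times a Gegenbauer polynomial, which avoids Euler's transformation. For \<open>n = 0\<close> the series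
  is binomial; the coefficient \<open>n\<close> of the last term of the recurrence makes the step to \<open>n = 1\<close> work.
\<close>
lemma hyp2F1_reg_eq_gegenbauer:
  assumes l: "2 * l \<notin> \<int>\<^sub>\<le>\<^sub>0" and w: "norm w < 1"
  shows "hyp2F1_reg (- of_nat n - l + 1 / 2) (of_nat n + l + 1 / 2) (l + 1 / 2) w =
    rGamma (l + 1 / 2) * (1 - w) powr (l - 1 / 2) * (fact n / pochhammer (2 * l) n * gegenbauer l n (1 - 2
        * w))"
proof -
  have l': "l + 1 / 2 \<notin> \<int>\<^sub>\<le>\<^sub>0" using l by (rule half_notin_nonpos_Ints)
  define F where "F n = hyp2F1_reg (- of_nat n - l + 1 / 2) (of_nat n + l + 1 / 2) (l + 1 / 2) w" for n
  define E where "E = rGamma (l + 1 / 2) * (1 - w) powr (l - 1 / 2)"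
  have nz: "pochhammer (2 * l) k \<noteq> 0" "2 * l + of_nat k \<noteq> 0" for k
    using l by (auto dest: pochhammer_eq_0_imp_nonpos_Int plus_of_nat_eq_0_imp)
  have nzE: "E \<noteq> 0" using w l' by (auto simp: E_def rGamma_eq_zero_iff)
  have F0: "F 0 = E"
  proof -
    have "(\<lambda>k. rGamma (l + 1 / 2) * (pochhammer (1 / 2 - l) k / fact k * w ^ k)) sums
      (rGamma (l + 1 / 2) * (1 - w) powr (- (1 / 2 - l)))"
      using w by (intro sums_mult sums_neg_powr)
    moreover have "pochhammer (l + 1 / 2) k \<noteq> 0" for k
      using l' by (auto dest: pochhammer_eq_0_imp_nonpos_Int)
    ultimately have "(\<lambda>k. rGamma (l + 1 / 2) * (pochhammer (1 / 2 - l) k * pochhammer (l + 1 / 2) k /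
        (fact k * pochhammer (l + 1 / 2) k)) * w ^ k) sums E"
      by (simp add: E_def mult.assoc)
    then show ?thesis
      using hyp2F1_reg_sums[OF l' w, of "1 / 2 - l" "l + 1 / 2"] sums_unique2
      by (force simp: F_def)
  qed
  have rec: "(of_nat n + 2 * l) * F (Suc n) = 2 * (of_nat n + l) * (1 - 2 * w) * F n - of_nat n * F (n -
      1)" for n
  proof -
    have 1: "F (Suc n) = hyp2F1_reg (- of_nat n - l - 1 / 2) (of_nat n + l + 3 / 2) (l + 1 / 2) w"
      unfolding F_def by (rule arg_cong2[where f = "\<lambda>a b. hyp2F1_reg a b _ _"]) simp_all
    have 2: "of_nat n * F (n - 1) =
        of_nat n * hyp2F1_reg (- of_nat n - l + 3 / 2) (of_nat n + l - 1 / 2) (l + 1 / 2) w"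
    proof (cases n)
      case (Suc k)
      then show ?thesis
        unfolding F_def by (intro arg_cong2[where f = "\<lambda>a b. of_nat n * hyp2F1_reg a b _ _"]) simp_all
    qed simp
    show ?thesis unfolding 1 2 using hyp2F1_reg_contiguous[OF l' w, of "of_nat n"] by (simp only: F_def)
  qed
  have F1: "F (Suc 0) = (1 - 2 * w) * E"
    using rec[of 0] nz(2)[of 0] F0 by simp
  have "pochhammer (2 * l) n / fact n * (F n / E) = gegenbauer l n (1 - 2 * w)" for n
  proof (rule gegenbauer_unique)
    show "pochhammer (2 * l) 0 / fact 0 * (F 0 / E) = 1" using F0 nzE by simp
    show "pochhammer (2 * l) (Suc 0) / fact (Suc 0) * (F (Suc 0) / E) = 2 * l * (1 - 2 * w)"
      using F1 nzE by simp
    fix n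
    define P where "P = pochhammer (2 * l) (Suc n) / fact (Suc n) / E"
    have *: "of_nat n + 2 \<noteq> (0::complex)" "of_nat n + 1 \<noteq> (0::complex)"
      using of_nat_neq_0[of "Suc n", where 'a = complex] of_nat_neq_0[of n, where 'a = complex] by
          (simp_all add: add_ac)
    have 1: "(of_nat n + 2) * (pochhammer (2 * l) (Suc (Suc n)) / fact (Suc (Suc n)) * (F (Suc (Suc n)) / E))
       = P * ((of_nat (Suc n) + 2 * l) * F (Suc (Suc n)))"
      using * nzE unfolding P_def pochhammer_rec'[of _ "Suc n"] fact_Suc[of "Suc n"]
      by (simp add: divide_simps add_ac del: fact_Suc)
    have 2: "pochhammer (2 * l) (Suc n) / fact (Suc n) * (F (Suc n) / E) = P * F (Suc n)"
      by (simp add: P_def)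
    have 3: "(of_nat n + 2 * l) * (pochhammer (2 * l) n / fact n * (F n / E)) = P * (of_nat (Suc n) * F n)"
      using * nzE unfolding P_def pochhammer_rec'[of _ n] fact_Suc
      by (simp add: divide_simps add_ac)
    show "(of_nat n + 2) * (pochhammer (2 * l) (Suc (Suc n)) / fact (Suc (Suc n)) * (F (Suc (Suc n)) / E)) =
      2 * (1 - 2 * w) * (of_nat n + 1 + l) * (pochhammer (2 * l) (Suc n) / fact (Suc n) * (F (Suc n) / E)) -
      (of_nat n + 2 * l) * (pochhammer (2 * l) n / fact n * (F n / E))"
      unfolding 1 2 3 rec by (simp add: algebra_simps)
  qed
  from this[of n] have "F n = E * (fact n / pochhammer (2 * l) n * gegenbauer l n (1 - 2 * w))"
    using nz(1)[of n] nzE by (simp add: field_simps)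
  then show ?thesis by (simp add: F_def E_def)
qed

lemma Ferrers_P_eq_gegenbauer:
  assumes m: "2 * m + 1 \<notin> \<int>\<^sub>\<le>\<^sub>0" and x: "x \<notin> complex_of_real ` ({..-1} \<union> {1..})"
  shows "Ferrers_P (of_nat n + m) (- m) x =
    2 powr (- m) * (1 - x\<^sup>2) powr (m / 2) * rGamma (m + 1) * (fact n / pochhammer (2 * m + 1) n *
        gegenbauer (m + 1 / 2) n x)"
proof -
  let ?g = "\<lambda>x. 2 powr (- m) * (1 - x\<^sup>2) powr (m / 2) * rGamma (m + 1) * (fact n / pochhammer (2 * m + 1)
      n * gegenbauer (m + 1 / 2) n x)"
  define D where "D = - complex_of_real ` ({..-1} \<union> {1..})"
  have D: "t \<in> D \<longleftrightarrow> Im t \<noteq> 0 \<or> \<bar>Re t\<bar> < 1" for t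
  proof -
    have "t \<in> complex_of_real ` X \<longleftrightarrow> Im t = 0 \<and> Re t \<in> X" for X
      by (auto simp: image_iff complex_eq_iff)
    from this[of "{..-1} \<union> {1..}"] show ?thesis
      unfolding D_def Compl_iff by (simp only: Un_iff atMost_iff atLeast_iff) auto
  qed
  have "D = {t. Im t \<noteq> 0} \<union> ({t. Re t < 1} \<inter> {t. - 1 < Re t})"
    by (intro set_eqI) (auto simp: D abs_less_iff)
  also have "open \<dots>" by (intro open_Un open_Int open_Collect_neq open_Collect_less continuous_intros)
  finally have "open D" .
  have "starlike D"
  proof -
    have "closed_segment 0 z \<subseteq> D" if z: "z \<in> D" for z
    proof
      fix w assume "w \<in> closed_segment 0 z"
      then obtain u where u: "0 \<le> u" "u \<le> 1" "w = u *\<^sub>R z"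
        unfolding closed_segment_def by auto
      have "u * \<bar>Re z\<bar> \<le> \<bar>Re z\<bar>" using u mult_right_mono[of u 1 "\<bar>Re z\<bar>"] by simp
      then have "Im w \<noteq> 0 \<or> \<bar>Re w\<bar> < 1"
        using u(1) z unfolding u(3) D by (cases "u = 0") (auto simp: abs_mult)
      then show "w \<in> D" using D by simp
    qed
    moreover have "0 \<in> D" by (simp add: D)
    ultimately show ?thesis unfolding starlike_def by blast
  qed
  then have "connected D" by (rule starlike_imp_connected)
  have nonpos: "1 - t\<^sup>2 \<notin> \<real>\<^sub>\<le>\<^sub>0" if "t \<in> D" for t
  proof
    assume "1 - t\<^sup>2 \<in> \<real>\<^sub>\<le>\<^sub>0"
    then have "Re t * Im t = 0" "1 + Im t ^ 2 \<le> Re t ^ 2" 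
      by (auto simp: complex_nonpos_Reals_iff power2_eq_square)
    moreover have "Re t \<noteq> 0" using calculation by (auto, smt (verit) zero_le_power2)
    ultimately have "Im t = 0" "1 \<le> Re t ^ 2" by auto
    then show False using that abs_square_less_1[of "Re t"] by (simp add: D)
  qed
  have "?g holomorphic_on D"
    using nonpos by (intro holomorphic_intros) auto
  moreover have "?g t = ((1 - t) / (1 + t)) powr (- (- m) / 2) *
      hyp2F1_reg (- (of_nat n + m)) (of_nat n + m + 1) (- (- m) + 1) ((1 - t) / 2)"
    if t: "t \<in> complex_of_real ` {-1<..<1}" for t
  proof -
    obtain u where u: "t = of_real u" "-1 < u" "u < 1" using t by auto
    have "norm ((1 - t) / 2) = norm (complex_of_real ((1 - u) / 2))" by (simp add: u(1))
    also have "\<dots> = \<bar>(1 - u) / 2\<bar>" by (rule norm_of_real)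
    finally have w: "norm ((1 - t) / 2) < 1" using u(2,3) by simp
    have q: "(1 - t) / (1 + t) = of_real ((1 - u) / (1 + u))" "1 - t\<^sup>2 = of_real ((1 - u) * (1 + u))"
       "1 - (1 - t) / 2 = of_real ((1 + u) / 2)"
      by (simp_all add: u(1) power2_eq_square field_simps)
    have pw: "of_real y powr c = exp (c * of_real (ln y))" if "y > 0" for y and c :: complex
      using that by (simp add: powr_def Ln_of_real)
    have "((1 - t) / (1 + t)) powr (m / 2) * (1 - (1 - t) / 2) powr m = 2 powr (- m) * (1 - t\<^sup>2) powr (m / 2)"
    proof -
      have "of_real ((1 - u) / (1 + u)) powr (m / 2) = exp (m / 2 * of_real (ln (1 - u) - ln (1 + u)))"
        "of_real ((1 + u) / 2) powr m = exp (m * of_real (ln (1 + u) - ln 2))"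
        "of_real ((1 - u) * (1 + u)) powr (m / 2) = exp (m / 2 * of_real (ln (1 - u) + ln (1 + u)))"
        "2 powr (- m) = exp (- m * of_real (ln 2))"
        using pw[of 2 "- m"] u by (simp_all add: pw ln_mult ln_div del: of_real_divide of_real_mult)
      then show ?thesis
        unfolding q by (simp only:) (simp add: algebra_simps diff_divide_distrib add_divide_distrib flip:
            exp_add)
    qed
    moreover have "hyp2F1_reg (- (of_nat n + m)) (of_nat n + m + 1) (m + 1) ((1 - t) / 2) =
       rGamma (m + 1) * (1 - (1 - t) / 2) powr m * (fact n / pochhammer (2 * m + 1) n * gegenbauer (m + 1
           / 2) n t)"
    proof -
      have e: "1 - 2 * ((1 - t) / 2) = t" by (simp add: field_simps)
      show ?thesis
        using hyp2F1_reg_eq_gegenbauer[of "m + 1 / 2" "(1 - t) / 2" n, unfolded e] m w by (simp add: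
            algebra_simps)
    qed
    ultimately show ?thesis by (simp add: mult_ac)
  qed
  moreover have "complex_of_real ` {-1<..<1} \<subseteq> D" by (auto simp: D)
  moreover have "0 \<in> D" "x \<in> D" using x by (simp add: D, simp add: D_def)
  ultimately show ?thesis
    unfolding Ferrers_P_def D_def[symmetric] using islimpt_unit_interval \<open>open D\<close> \<open>connected D\<close>
    by (intro analytic_extension_eq[where \<xi> = 0 and g = ?g])
qed

section \<open>A quadratic transformation and the function of the second kind\<close>

text \<open>
  A form of the Chu--Vandermonde sum.
\<close>
lemma sum_Vandermonde_quadratic:
  assumes c: "c \<notin> \<int>\<^sub>\<le>\<^sub>0"
  shows "(\<Sum>k\<le>m. pochhammer A (m + k) * (- 1) ^ (m - k) / (fact k * pochhammer c k * fact (m - k))) =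
     pochhammer A m * pochhammer (A - c + 1) m / (fact m * pochhammer (c::complex) m)"
proof -
  have nz: "pochhammer c k \<noteq> 0" for k using c by (auto dest: pochhammer_eq_0_imp_nonpos_Int)
  have cn: "\<forall>i\<in>{0..<m}. c \<noteq> - of_nat i" using c by auto
  have p: "pochhammer (- of_nat m) k = (- 1) ^ k * fact m / (fact (m - k) :: complex)" if "k \<le> m" for k
  proof -
    have "of_nat (m choose k) = (- 1) ^ k * pochhammer (- of_nat m) k / (fact k :: complex)"
      by (simp add: binomial_gbinomial gbinomial_pochhammer)
    then have "pochhammer (- of_nat m) k = (- 1) ^ k * (fact k * of_nat (m choose k) :: complex)"
      by (simp add: field_simps flip: power_mult_distrib)
    then show ?thesis using that by (simp add: binomial_fact)
  qed
  have "(\<Sum>k\<le>m. pochhammer A (m + k) * (- 1) ^ (m - k) / (fact k * pochhammer c k * fact (m - k))) =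
     (\<Sum>k\<le>m. (- 1) ^ m * pochhammer A m / fact m * (pochhammer (A + of_nat m) k * pochhammer (- of_nat m) k
         / (of_nat (fact k) * pochhammer c k)))"
  proof (intro sum.cong refl)
    fix k assume "k \<in> {..m}"
    then have k: "k \<le> m" by simp
    have "pochhammer A (m + k) = pochhammer A m * pochhammer (A + of_nat m) k"
      by (rule pochhammer_product')
    moreover have "(- 1 :: complex) ^ (m - k) = (- 1) ^ m * (- 1) ^ k"
    proof -
      obtain d where "m = d + k" using k le_Suc_ex by (metis add.commute)
      then show ?thesis by (simp add: power_add mult.assoc flip: power_mult_distrib)
    qed
    ultimately show "pochhammer A (m + k) * (- 1) ^ (m - k) / (fact k * pochhammer c k * fact (m - k)) =
      (- 1) ^ m * pochhammer A m / fact m * (pochhammer (A + of_nat m) k * pochhammer (- of_nat m) k /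
          (of_nat (fact k) * pochhammer c k))"
      using nz[of k] by (simp add: p[OF k] field_simps)
  qed
  also have "\<dots> = (- 1) ^ m * pochhammer A m / fact m * (pochhammer (c - (A + of_nat m)) m / pochhammer c m)"
    using Vandermonde_pochhammer[OF cn, of "A + of_nat m"]
    unfolding sum_distrib_left[symmetric] by (simp only: atMost_atLeast0)
  also have "pochhammer (c - (A + of_nat m)) m = (- 1) ^ m * pochhammer (A - c + 1) m"
    using pochhammer_minus[of "A + of_nat m - c" m] by (simp add: algebra_simps)
  finally show ?thesis by (simp add: field_simps flip: power_mult_distrib)
qed

lemma fact_trinomial_le: "fact (2 * k + j) / (fact k * fact k * fact j) \<le> (16 ^ k * 2 ^ j :: real)"
proof -
  have "fact (2 * k + j) / (fact k * fact k * fact j) = real ((2 * k + j) choose j) * real ((2 * k) choose k)"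
    by (simp add: binomial_fact mult_2)
  also have "\<dots> \<le> 2 ^ (2 * k + j) * 2 ^ (2 * k)"
    using of_nat_mono[where 'a = real, OF binomial_le_pow2[of "2 * k + j" j]]
      of_nat_mono[where 'a = real, OF binomial_le_pow2[of "2 * k" k]]
    by (intro mult_mono) simp_all
  also have "\<dots> = (2 ^ 2 * 2 ^ 2) ^ k * 2 ^ j"
    unfolding power_add power_mult power_mult_distrib by (simp only: mult_ac)
  also have "2 ^ 2 * 2 ^ 2 = (16 :: real)" by simp
  finally show ?thesis .
qed

text \<open>
  Gauss's quadratic transformation near the origin. Expanding the powers of \<open>1 + q\<close> on the left gives a
  double series which is summed along its diagonals by the Chu--Vandermonde formula. The radius \<open>1/32\<close> is
  small enough for absolute convergence of the double series; nothing larger is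
  needed where the formula is combined with the identity theorem.
\<close>
lemma hyp2F1_quadratic:
  assumes c: "c \<notin> \<int>\<^sub>\<le>\<^sub>0" and q: "norm q < 1 / 32"
  shows "(1 + q) powr (- 2 * a) * hyp2F1_reg a (a + 1 / 2) c (4 * q / (1 + q)\<^sup>2) =
    hyp2F1_reg (2 * a) (2 * a - c + 1) c q"
proof -
  define f where "f = (\<lambda>(k, j). rGamma c * (pochhammer (2 * a) (2 * k + j) / (fact k * pochhammer c k *
      fact j) * (- 1) ^ j) * q ^ (k + j))"
  have nz: "pochhammer c k \<noteq> 0" for k using c by (auto dest: pochhammer_eq_0_imp_nonpos_Int)
  have q1: "norm (1 + q) \<ge> 31 / 32"
    using norm_triangle_ineq2[of 1 "- q"] q by simp
  have nz1: "1 + q \<noteq> 0" using q1 by auto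
  have "4 * norm q < 1 * (31 / 32) ^ 2" using q by (simp add: power2_eq_square)
  also have "\<dots> \<le> norm (1 + q) ^ 2" using power_mono[OF q1, of 2] by simp
  finally have arg: "norm (4 * q / (1 + q)\<^sup>2) < 1"
    using nz1 by (simp add: norm_mult norm_divide norm_power)
  \<comment> \<open>the growth rate \<open>5/4\<close> is admissible since \<open>16 (5/4)\<^sup>3 / 32 < 1\<close>\<close>
  obtain K where K: "K \<ge> 0" "\<And>n. norm (pochhammer (2 * a) n / fact n) \<le> K * (5 / 4) ^ n"
    using subexponentialE[OF subexponential_pochhammer_fact, of "5 / 4"] by auto
  obtain L where L: "L \<ge> 0" "\<And>n. norm (pochhammer 1 n / pochhammer c n) \<le> L * (5 / 4) ^ n"
    using subexponentialE[OF subexponential_pochhammer_ratio[OF c, of 1], of "5 / 4"] by auto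
  have "(\<lambda>p. norm (f p)) summable_on UNIV"
  proof (rule abs_summable_geometric_bound)
    fix k j
    have "f (k, j) = rGamma c * (pochhammer (2 * a) (2 * k + j) / fact (2 * k + j)) * (pochhammer 1 k /
        pochhammer c k) *
        (fact (2 * k + j) / (fact k * fact k * fact j)) * ((- 1) ^ j * q ^ (k + j))"
      by (simp add: f_def pochhammer_fact[symmetric] divide_simps)
    then have "norm (f (k, j)) = norm (rGamma c) * norm (pochhammer (2 * a) (2 * k + j) / fact (2 * k +
        j)) * norm (pochhammer 1 k / pochhammer c k) *
        (fact (2 * k + j) / (fact k * fact k * fact j)) * norm q ^ (k + j)"
      by (simp only: norm_mult norm_divide norm_power norm_fact norm_minus_cancel norm_one power_one mult_1)
    also have "\<dots> \<le> norm (rGamma c) * (K * (5 / 4) ^ (2 * k + j)) * (L * (5 / 4) ^ k) * (16 ^ k * 2 ^ j) *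
        norm q ^ (k + j)"
      using K L fact_trinomial_le by (intro mult_mono mult_nonneg_nonneg order_refl) auto
    also have "\<dots> = norm (rGamma c) * K * L * (((5 / 4) ^ 2) ^ k * (5 / 4) ^ k * 16 ^ k * norm q ^ k) * ((5
        / 4) ^ j * 2 ^ j * norm q ^ j)"
      unfolding power_add power_mult by (simp only: mult_ac)
    also have "((5 / 4) ^ 2) ^ k * (5 / 4) ^ k * 16 ^ k * norm q ^ k = ((5 / 4) ^ 2 * (5 / 4) * 16 * norm
        q) ^ k"
      by (simp only: power_mult_distrib)
    also have "(5 / 4) ^ j * 2 ^ j * norm q ^ j = (5 / 4 * 2 * norm q) ^ j"
      by (simp only: power_mult_distrib)
    finally show "norm (f (k, j)) \<le> norm (rGamma c) * K * L * ((5 / 4) ^ 2 * (5 / 4) * 16 * norm q) ^ k *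
        (5 / 4 * 2 * norm q) ^ j" .
  qed (use q in \<open>auto simp: power2_eq_square\<close>)
  note sm = this
  have row: "(\<lambda>j. f (k, j)) sums ((1 + q) powr (- 2 * a) * (rGamma c * (pochhammer a k * pochhammer (a + 1
      / 2) k / (fact k * pochhammer c k)) * (4 * q / (1 + q)\<^sup>2) ^ k))" for k
  proof -
    have "(\<lambda>j. pochhammer (2 * a + of_nat (2 * k)) j / fact j * (- q) ^ j) sums (1 - (- q)) powr (- (2 * a
        + of_nat (2 * k)))"
      using q by (intro sums_neg_powr) auto
    then have "(\<lambda>j. rGamma c * (pochhammer (2 * a) (2 * k) / (fact k * pochhammer c k)) * q ^ k *
        (pochhammer (2 * a + of_nat (2 * k)) j / fact j * (- q) ^ j)) sums
       (rGamma c * (pochhammer (2 * a) (2 * k) / (fact k * pochhammer c k)) * q ^ k * (1 - (- q)) powr (-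
           (2 * a + of_nat (2 * k))))"
      by (rule sums_mult)
    moreover have "rGamma c * (pochhammer (2 * a) (2 * k) / (fact k * pochhammer c k)) * q ^ k *
        (pochhammer (2 * a + of_nat (2 * k)) j / fact j * (- q) ^ j) = f (k, j)" for j
      unfolding f_def pochhammer_product' power_minus[of q] by (simp add: power_add mult_ac)
    moreover have "(1 - (- q)) powr (- (2 * a + of_nat (2 * k))) = (1 + q) powr (- 2 * a) / ((1 + q)\<^sup>2) ^ k"
    proof -
      have "(1 + q) powr (- 2 * a - of_nat (2 * k)) = (1 + q) powr (- 2 * a) / (1 + q) powr of_nat (2 * k)"
        by (rule powr_diff)
      also have "(1 + q) powr of_nat (2 * k) = ((1 + q)\<^sup>2) ^ k"
        using nz1 powr_nat'[of "1 + q" "2 * k"] by (simp only: power_mult) simp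
      finally show ?thesis by (simp add: algebra_simps)
    qed
    moreover have "pochhammer (2 * a) (2 * k) = 4 ^ k * (pochhammer a k * pochhammer (a + 1 / 2) k)"
      by (simp add: pochhammer_double power_mult)
    ultimately show ?thesis by (simp add: power_divide power_mult_distrib mult_ac)
  qed
  have "(\<lambda>k. (1 + q) powr (- 2 * a) * (rGamma c * (pochhammer a k * pochhammer (a + 1 / 2) k / (fact k *
      pochhammer c k)) * (4 * q / (1 + q)\<^sup>2) ^ k))
     sums ((1 + q) powr (- 2 * a) * hyp2F1_reg a (a + 1 / 2) c (4 * q / (1 + q)\<^sup>2))"
    by (intro sums_mult hyp2F1_reg_sums c arg)
  with sums_over_rows[OF sm row]
  have 1: "infsum f UNIV = (1 + q) powr (- 2 * a) * hyp2F1_reg a (a + 1 / 2) c (4 * q / (1 + q)\<^sup>2)"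
    by (rule sums_unique2)
  have fin: "finite {p. fst p + snd p = m}" for m :: nat
  proof (rule finite_subset)
    show "{p. fst p + snd p = m} \<subseteq> {..m} \<times> {..m}" by auto
  qed simp
  have "(\<Sum>p | fst p + snd p = m. f p) = rGamma c * (pochhammer (2 * a) m * pochhammer (2 * a - c + 1) m /
      (fact m * pochhammer c m)) * q ^ m" for m
  proof -
    have "(\<Sum>p | fst p + snd p = m. f p) = (\<Sum>k\<le>m. f (k, m - k))"
      by (rule sum.reindex_bij_witness[of _ "\<lambda>k. (k, m - k)" fst]) auto
    also have "\<dots> = (\<Sum>k\<le>m. rGamma c * (pochhammer (2 * a) (m + k) * (- 1) ^ (m - k) / (fact k * pochhammer
        c k * fact (m - k))) * q ^ m)"
    proof (intro sum.cong refl)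
      fix k assume "k \<in> {..m}"
      then have "2 * k + (m - k) = m + k" "k + (m - k) = m" by auto
      then show "f (k, m - k) = rGamma c * (pochhammer (2 * a) (m + k) * (- 1) ^ (m - k) / (fact k *
          pochhammer c k * fact (m - k))) * q ^ m"
        by (simp only: f_def prod.case times_divide_eq_left)
    qed
    finally show ?thesis
      unfolding sum_distrib_left[symmetric] sum_distrib_right[symmetric] sum_Vandermonde_quadratic[OF c] .
  qed
  with sums_over_fibres[OF sm fin]
  have "(\<lambda>m. rGamma c * (pochhammer (2 * a) m * pochhammer (2 * a - c + 1) m / (fact m * pochhammer c m))
      * q ^ m) sums infsum f UNIV"
    by simp
  moreover have "norm q < 1" using q by simp
  ultimately have "infsum f UNIV = hyp2F1_reg (2 * a) (2 * a - c + 1) c q"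
    using hyp2F1_reg_sums[OF c] sums_unique2 by blast
  with 1 show ?thesis by simp
qed

text \<open>
  With \<open>p = joukowski z\<close> and \<open>q = p\<^sup>2\<close> one has \<open>1/z\<^sup>2 = 4 q / (1 + q)\<^sup>2\<close>. The series in \<open>p\<^sup>2\<close> converges on the
  whole slit plane and hence represents the analytic continuation of the series in \<open>1/z\<^sup>2\<close>.
\<close>
lemma Olver_Q_eq:
  assumes c: "v + 3 / 2 \<notin> \<int>\<^sub>\<le>\<^sub>0" and z: "z \<notin> complex_of_real ` {..1}"
  shows "Olver_Q v m z = of_real (sqrt pi) * sq_minus_one_powr z (m / 2) / 2 powr (v + 1) *
    (2 * joukowski z) powr (v + m + 1) * hyp2F1_reg (v + m + 1) (m + 1 / 2) (v + 3 / 2) (joukowski z ^ 2)"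
proof -
  define S where "S = - complex_of_real ` {..1}"
  define A where "A = {z. norm z > 1} - complex_of_real ` {..1}"
  define f where "f z = of_real (sqrt pi) * sq_minus_one_powr z (m / 2) / (2 powr (v + 1) * z powr (v + m + 1))
            * hyp2F1_reg ((v + m + 1) / 2) ((v + m + 2) / 2) (v + 3 / 2) (1 / z ^ 2)" for z
  define g where "g z = of_real (sqrt pi) * sq_minus_one_powr z (m / 2) / 2 powr (v + 1) *
    (2 * joukowski z) powr (v + m + 1) * hyp2F1_reg (v + m + 1) (m + 1 / 2) (v + 3 / 2) (joukowski z ^ 2)" for z
  have J: "joukowski t \<noteq> 0" "2 * joukowski t \<notin> \<real>\<^sub>\<le>\<^sub>0" "norm (joukowski t ^ 2) < 1" if "t \<in> S" for t
    using joukowski[of t] that by (auto simp: S_def norm_power power_less_one_iff complex_nonpos_Reals_iff)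
  have sq: "(\<lambda>z. sq_minus_one_powr z (m / 2)) holomorphic_on S"
    unfolding sq_minus_one_powr_def by (intro holomorphic_intros) (auto simp: S_def dest: slit_nonpos_Reals)
  have "(\<lambda>z. hyp2F1_reg (v + m + 1) (m + 1 / 2) (v + 3 / 2) (joukowski z ^ 2)) holomorphic_on S"
  proof (rule holomorphic_on_compose_gen[OF _ hyp2F1_reg_holomorphic[OF c], of "\<lambda>z. joukowski z ^ 2" S,
      unfolded o_def])
    show "(\<lambda>z. joukowski z ^ 2) holomorphic_on S"
      unfolding S_def by (intro holomorphic_on_power holomorphic_joukowski)
    show "(\<lambda>z. joukowski z ^ 2) ` S \<subseteq> ball 0 1" using J(3) by auto
  qed
  then have g: "g holomorphic_on S"
    unfolding g_def using J(2) holomorphic_joukowski[folded S_def] sq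
    by (intro holomorphic_intros) auto
  have AS: "A \<subseteq> S" by (auto simp: A_def S_def)
  have "(\<lambda>z. hyp2F1_reg ((v + m + 1) / 2) ((v + m + 2) / 2) (v + 3 / 2) (1 / z ^ 2)) holomorphic_on A"
  proof (rule holomorphic_on_compose_gen[OF _ hyp2F1_reg_holomorphic[OF c], of "\<lambda>z. 1 / z ^ 2" A, unfolded
      o_def])
    show "(\<lambda>z. 1 / z ^ 2) holomorphic_on A" by (intro holomorphic_intros) (auto simp: A_def)
    show "(\<lambda>z. 1 / z ^ 2) ` A \<subseteq> ball 0 1"
    proof
      fix w assume "w \<in> (\<lambda>z. 1 / z ^ 2) ` A"
      then obtain z where z: "w = 1 / z ^ 2" "norm z > 1" by (auto simp: A_def)
      then have "1 < norm z ^ 2" by (simp add: one_less_power)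
      then have "1 / norm z ^ 2 < 1" by (subst divide_less_eq_1_pos) auto
      then show "w \<in> ball 0 1" by (simp add: z norm_divide norm_power)
    qed
  qed
  then have f: "f holomorphic_on A"
    unfolding f_def using holomorphic_on_subset[OF sq AS]
    by (intro holomorphic_intros) (auto simp: A_def dest: slit_nonpos_Reals)
  \<comment> \<open>for real \<open>t > 15\<close> one has \<open>q \<le> 1/64\<close>, and all powers are those of positive reals\<close>
  have U: "f t = g t" if tU: "t \<in> complex_of_real ` {15<..}" for t
  proof -
    obtain u where u: "t = of_real u" "u > 15" using tU by auto
    then obtain p where p: "joukowski t = of_real p" "0 < p" "p < 1" "p \<le> 2 / (u + 1)"
      using joukowski_real[of u] by auto
    define q where "q = p ^ 2"
    have "2 / (u + 1) \<le> 2 / 16" using u by (intro divide_left_mono) auto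
    then have "p \<le> 1 / 8" using p(4) by linarith
    then have "q \<le> (1 / 8) ^ 2" unfolding q_def using p by (intro power_mono) auto
    then have q: "norm (of_real q :: complex) < 1 / 32" "q > 0"
      unfolding norm_of_real using p by (auto simp: q_def power2_eq_square)
    have "t \<in> S" using u by (auto simp: S_def)
    then have "1 + of_real q = 2 * t * of_real p"
      using joukowski(4)[of t] by (simp add: S_def p q_def)
    then have "complex_of_real (1 + q) = of_real (2 * u * p)" by (simp add: u)
    then have t: "1 + q = 2 * u * p" unfolding of_real_eq_iff .
    have "4 * of_real q / (1 + of_real q)\<^sup>2 = complex_of_real (4 * q / (1 + q)\<^sup>2)" by simp
    also have "4 * q / (1 + q)\<^sup>2 = 1 / u\<^sup>2"
      unfolding t unfolding q_def using p u by (simp add: power_mult_distrib)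
    finally have arg: "4 * of_real q / (1 + of_real q)\<^sup>2 = 1 / t\<^sup>2" by (simp add: u)
    define B where "B = v + m + 1"
    have B: "(v + m + 2) / 2 = B / 2 + 1 / 2" "m + 1 / 2 = 2 * (B / 2) - (v + 3 / 2) + 1"
      by (simp_all add: B_def field_simps)
    have pw: "of_real y powr c = exp (c * of_real (ln y))" if "y > 0" for y and c :: complex
      using that by (simp add: powr_def Ln_of_real)
    have "ln (1 + q) = ln u + ln (2 * p)" unfolding t using p u by (simp add: ln_mult)
    then have pwr: "(1 + of_real q) powr (- 2 * (B / 2)) * (2 * joukowski t) powr B = 1 / t powr B"
      using pw[of "1 + q" "- B"] pw[of "2 * p" B] pw[of u B] p(1,2) u q(2)
      by (simp add: exp_minus field_simps flip: exp_add)
    have jq: "joukowski t ^ 2 = of_real q" by (simp add: p q_def)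
    have H: "hyp2F1_reg B (m + 1 / 2) (v + 3 / 2) (of_real q) =
        (1 + of_real q) powr (- 2 * (B / 2)) * hyp2F1_reg (B / 2) (B / 2 + 1 / 2) (v + 3 / 2) (1 / t\<^sup>2)"
      using hyp2F1_quadratic[OF c q(1), of "B / 2", unfolded arg] unfolding B(2) by simp
    let ?C = "of_real (sqrt pi) * sq_minus_one_powr t (m / 2) / 2 powr (v + 1)"
    have "f t = ?C * (1 / t powr B) * hyp2F1_reg (B / 2) (B / 2 + 1 / 2) (v + 3 / 2) (1 / t\<^sup>2)"
      unfolding f_def B_def[symmetric] B(1) by simp
    also have "\<dots> = g t"
      unfolding pwr[symmetric] g_def B_def[symmetric] jq H by (simp only: mult_ac)
    finally show ?thesis .
  qed
  have A: "open A" "connected A" "16 \<in> A"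
    using open_exterior connected_exterior not_in_slit_iff[of 16] by (simp_all add: A_def)
  have eq: "g t = f t" if t: "t \<in> A" for t
  proof -
    have lim: "16 islimpt complex_of_real ` {15<..}"
      unfolding islimpt_approachable
    proof (intro allI impI)
      fix e :: real assume "e > 0"
      moreover have "dist (complex_of_real (16 + e / 2)) 16 = e / 2"
        using \<open>e > 0\<close> by (simp add: dist_norm)
      moreover have "complex_of_real (16 + e / 2) \<in> complex_of_real ` {15<..}"
        using \<open>e > 0\<close> by (intro imageI) simp
      ultimately show "\<exists>x'\<in>complex_of_real ` {15<..}. x' \<noteq> 16 \<and> dist x' 16 < e"
        by (intro bexI[of _ "of_real (16 + e / 2)"]) auto
    qed
    have sub: "complex_of_real ` {15<..} \<subseteq> A"
      unfolding A_def image_subset_iff Diff_iff not_in_slit_iff mem_Collect_eq norm_of_real by simp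
    have hol: "(\<lambda>t. g t - f t) holomorphic_on A"
      using holomorphic_on_subset[OF g AS] f by (rule holomorphic_on_diff)
    have zero: "g w - f w = 0" if "w \<in> complex_of_real ` {15<..}" for w
      using U[OF that] by simp
    have "g t - f t = 0"
      by (rule analytic_continuation[OF hol A(1,2) sub A(3) lim zero t])
    then show ?thesis by simp
  qed
  have "16 islimpt A" using A by (intro open_imp_islimpt)
  moreover have "open S" "connected S" "z \<in> S"
    using open_slit connected_slit z by (simp_all add: S_def)
  ultimately have "analytic_extension f A S z = g z"
    using AS A(3) g eq by (intro analytic_extension_eq[where \<xi> = 16]) auto
  then show ?thesis unfolding Olver_Q_def f_def[abs_def] A_def S_def g_def .
qed

section \<open>The expansion\<close>

text \<open>
  The right-hand side is holomorphic in \<open>x\<close> inside the ellipse, since there the base of its last power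
  avoids the cut, and it agrees with the principal power of \<open>z - x\<close> on the interval \<open>(-1, 1)\<close>.
\<close>
lemma diff_powr_eq:
  assumes s: "s > 2" and z: "z \<in> confocal_ellipse s" "z \<notin> complex_of_real ` {..1}"
    and x: "x \<in> confocal_ellipse_interior s"
  shows "diff_powr s z a x = (2 * joukowski z) powr (- a) * (1 - 2 * x * joukowski z + joukowski z ^ 2) powr a"
  unfolding diff_powr_def
proof (rule analytic_extension_eq[where \<xi> = 0])
  show "(\<lambda>x. (2 * joukowski z) powr (- a) * (1 - 2 * x * joukowski z + joukowski z ^ 2) powr a)
      holomorphic_on confocal_ellipse_interior s"
  proof (intro holomorphic_intros)
    fix t assume "t \<in> confocal_ellipse_interior s"
    from ellipse_interior_param[OF z this] obtain r r' where
      r: "r * r' = 1" "r + r' = 2 * t" "norm (r * joukowski z) < 1" "norm (r' * joukowski z) < 1"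
      by metis
    show "1 - 2 * t * joukowski z + joukowski z ^ 2 \<notin> \<real>\<^sub>\<le>\<^sub>0"
      by (rule gegenbauer_generating_function[OF r])
  qed
  show "(2 * joukowski z) powr (- a) * (1 - 2 * t * joukowski z + joukowski z ^ 2) powr a = (z - t) powr a"
    if "t \<in> complex_of_real ` {-1<..<1}" for t
    using that powr_joukowski_diff[OF z(2)] by auto
  show "0 \<in> confocal_ellipse_interior s" using s by (simp add: confocal_ellipse_interior_def)
qed (use x unit_interval_subset_interior[OF s] islimpt_unit_interval open_ellipse_interior
      convex_connected[OF convex_ellipse_interior] in auto)

text \<open>
  The expansion of one generating function in Gegenbauer polynomials of another parameter: the
  coefficient of \<open>w\<^sup>m\<close> is rewritten by the connection formula, and the terms with the same
  \<open>n = m - 2 k\<close> are collected, their sum over \<open>k\<close> being a Gauss series in \<open>w\<^sup>2\<close>.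
\<close>
lemma gegenbauer_expansion:
  assumes l: "l \<notin> \<int>\<^sub>\<le>\<^sub>0"
    and r: "r * r' = 1" "r + r' = 2 * x" "norm r \<ge> 1"
    and w: "norm (r * w) < 1" "norm (r' * w) < 1" "norm w < 1"
  shows "(\<lambda>n. Gamma l * (of_nat n + l) * pochhammer v n * gegenbauer l n x * w ^ n
            * hyp2F1_reg (of_nat n + v) (v - l) (of_nat n + l + 1) (w ^ 2))
         sums (1 - 2 * x * w + w ^ 2) powr (- v)"
proof -
  define f where "f = (\<lambda>(n, k). connection_coeff v l (n + k) k * (of_nat n + l) * gegenbauer l n x * w ^
      (n + 2 * k))"
  have nzl: "pochhammer l k \<noteq> 0" "l + of_nat k \<noteq> 0" for k
    using l by (auto dest: pochhammer_eq_0_imp_nonpos_Int plus_of_nat_eq_0_imp)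
  have l1: "l + 1 \<notin> \<int>\<^sub>\<le>\<^sub>0"
    using add_of_nat_notin_nonpos_Ints[OF l, of 1] by simp
  have r0: "r \<noteq> 0" using r(1) by auto
  define M where "M = max (norm (r * w)) (norm w)"
  have M: "0 \<le> M" "M < 1" "norm (r * w) \<le> M" "norm w \<le> M" using w by (auto simp: M_def le_max_iff_disj)
  \<comment> \<open>the subexponential factors cost at most \<open>q\<^sup>3\<close> for each unit of \<open>n\<close> and \<open>q\<^sup>2\<close> for each unit of \<open>k\<close>\<close>
  obtain q where q: "1 < q" "q ^ 4 * M < 1"
  proof -
    have "((\<lambda>q. q ^ 4 * M) \<longlongrightarrow> 1 ^ 4 * M) (at_right 1)" by (intro tendsto_intros)
    then have "eventually (\<lambda>q. q ^ 4 * M < 1) (at_right 1)"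
      by (rule order_tendstoD) (use M in simp)
    moreover have "eventually (\<lambda>q::real. 1 < q) (at_right 1)" by (rule eventually_at_right_less)
    ultimately have "eventually (\<lambda>q. 1 < q \<and> q ^ 4 * M < 1) (at_right 1)" by eventually_elim auto
    then show ?thesis using that eventually_happens[of _ "at_right (1::real)"] by (auto simp:
        trivial_limit_at_right_real)
  qed
  obtain K1 where K1: "K1 \<ge> 0" "\<And>n. norm (pochhammer v n / pochhammer (l + 1) n) \<le> K1 * q ^ n"
    using subexponentialE[OF subexponential_pochhammer_ratio[OF l1, of v] q(1)] by metis
  obtain K2 where K2: "K2 \<ge> 0" "\<And>n. norm (pochhammer (v - l) n / fact n) \<le> K2 * q ^ n"
    using subexponentialE[OF subexponential_pochhammer_fact[of "v - l"] q(1)] by metis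
  obtain K3 where K3: "K3 \<ge> 0" "\<And>n. norm (of_nat n + l) \<le> K3 * q ^ n"
    using subexponentialE[OF subexponential_of_nat_add[of l] q(1)] by metis
  obtain K4 where K4: "K4 \<ge> 0" "\<And>n. norm (gegenbauer l n x / r ^ n) \<le> K4 * q ^ n"
    using subexponentialE[OF gegenbauer_subexponential[OF r, of l] q(1)] by metis
  have sm: "(\<lambda>p. norm (f p)) summable_on UNIV"
  proof (rule abs_summable_geometric_bound)
    fix n k
    have "f (n, k) = 1 / l * (pochhammer v (n + k) / pochhammer (l + 1) (n + k)) * (pochhammer (v - l) k /
        fact k)
       * (of_nat n + l) * (gegenbauer l n x / r ^ n) * ((r * w) ^ n * (w ^ 2) ^ k)"
      using r0 unfolding power_mult[symmetric]
      by (simp add: f_def connection_coeff_def pochhammer_rec power_mult_distrib power_add mult_ac)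
    then have "norm (f (n, k)) = 1 / norm l * norm (pochhammer v (n + k) / pochhammer (l + 1) (n + k)) *
        norm (pochhammer (v - l) k / fact k)
       * norm (of_nat n + l) * norm (gegenbauer l n x / r ^ n) * (norm (r * w) ^ n * (norm w ^ 2) ^ k)"
      by (simp only: norm_mult norm_power norm_divide norm_one)
    also have "\<dots> \<le> 1 / norm l * (K1 * q ^ (n + k)) * (K2 * q ^ k) * (K3 * q ^ n) * (K4 * q ^ n) * (M ^ n *
        (M ^ 2) ^ k)"
      using K1 K2 K3 K4 M q(1) by (intro mult_mono power_mono mult_nonneg_nonneg order_refl) auto
    also have "\<dots> = (1 / norm l * K1 * K2 * K3 * K4) * (q ^ n * q ^ n * q ^ n * M ^ n) * (q ^ k * q ^ k *
        (M ^ 2) ^ k)"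
      by (simp add: power_add mult_ac)
    also have "q ^ n * q ^ n * q ^ n * M ^ n = (q ^ 3 * M) ^ n"
      unfolding power_mult_distrib power3_eq_cube by simp
    also have "q ^ k * q ^ k * (M ^ 2) ^ k = (q ^ 2 * M ^ 2) ^ k"
      unfolding power_mult_distrib power2_eq_square by simp
    finally show "norm (f (n, k)) \<le> (1 / norm l * K1 * K2 * K3 * K4) * (q ^ 3 * M) ^ n * (q ^ 2 * M ^ 2) ^ k" .
  next
    have "q ^ 3 * M \<le> q ^ 4 * M" "q ^ 2 * M \<le> q ^ 4 * M"
      using q(1) M by (auto intro!: mult_right_mono power_increasing)
    moreover have "M * (q ^ 2 * M) \<le> 1 * (q ^ 2 * M)"
      using q(1) M by (intro mult_right_mono) auto
    ultimately show "q ^ 3 * M < 1" "q ^ 2 * M ^ 2 < 1" using q(2) by (auto simp: power2_eq_square mult_ac)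
    show "0 \<le> q ^ 3 * M" "0 \<le> q ^ 2 * M ^ 2" using q(1) M by auto
  qed
  have row: "(\<lambda>k. f (n, k)) sums (Gamma l * (of_nat n + l) * pochhammer v n * gegenbauer l n x * w ^ n
            * hyp2F1_reg (of_nat n + v) (v - l) (of_nat n + l + 1) (w ^ 2))" for n
  proof -
    have c: "of_nat n + l + 1 \<notin> \<int>\<^sub>\<le>\<^sub>0"
      using add_of_nat_notin_nonpos_Ints[OF l1, of n] by (simp add: add_ac)
    have "norm (w ^ 2) < 1" using w by (simp add: norm_power power_less_one_iff)
    then have "(\<lambda>k. Gamma l * (of_nat n + l) * pochhammer v n * gegenbauer l n x * w ^ n *
       (rGamma (of_nat n + l + 1) * (pochhammer (of_nat n + v) k * pochhammer (v - l) k / (fact k *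
           pochhammer (of_nat n + l + 1) k)) * (w ^ 2) ^ k))
       sums (Gamma l * (of_nat n + l) * pochhammer v n * gegenbauer l n x * w ^ n
            * hyp2F1_reg (of_nat n + v) (v - l) (of_nat n + l + 1) (w ^ 2))"
      by (intro sums_mult hyp2F1_reg_sums c)
    moreover have "Gamma l * (of_nat n + l) * pochhammer v n * gegenbauer l n x * w ^ n *
       (rGamma (of_nat n + l + 1) * (pochhammer (of_nat n + v) k * pochhammer (v - l) k / (fact k *
           pochhammer (of_nat n + l + 1) k)) * (w ^ 2) ^ k)
       = f (n, k)" for k
    proof -
      have 1: "pochhammer v n * pochhammer (of_nat n + v) k = pochhammer v (n + k)"
        unfolding add.commute[of "of_nat n" v] by (rule pochhammer_product'[symmetric])
      have 2: "Gamma l * rGamma (of_nat n + l + 1) / pochhammer (of_nat n + l + 1) k = 1 / pochhammer l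
          (Suc (n + k))"
      proof -
        have "pochhammer l (Suc (n + k)) = pochhammer l (Suc n) * pochhammer (of_nat n + l + 1) k"
          using pochhammer_product'[of l "Suc n" k] by (simp add: add_ac)
        moreover have "Gamma l * rGamma (of_nat n + l + 1) = 1 / pochhammer l (Suc n)"
        proof -
          have "Gamma l * rGamma l = 1" using l by (simp add: rGamma_inverse_Gamma Gamma_eq_zero_iff)
          moreover have "rGamma l = pochhammer l (Suc n) * rGamma (of_nat n + l + 1)"
            using pochhammer_rGamma[of l "Suc n"] by (simp add: add_ac)
          ultimately show ?thesis using nzl(1)[of "Suc n"] by (simp add: eq_divide_eq mult_ac)
        qed
        ultimately show ?thesis by simp
      qed
      have "Gamma l * (of_nat n + l) * pochhammer v n * gegenbauer l n x * w ^ n *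
       (rGamma (of_nat n + l + 1) * (pochhammer (of_nat n + v) k * pochhammer (v - l) k / (fact k *
           pochhammer (of_nat n + l + 1) k)) * (w ^ 2) ^ k)
       = (pochhammer v n * pochhammer (of_nat n + v) k) * (Gamma l * rGamma (of_nat n + l + 1) /
           pochhammer (of_nat n + l + 1) k)
         * (pochhammer (v - l) k / fact k) * (of_nat n + l) * gegenbauer l n x * (w ^ n * (w ^ 2) ^ k)"
        by (simp add: mult_ac)
      also have "\<dots> = f (n, k)"
        unfolding 1 2 f_def connection_coeff_def by (simp add: power_add power_mult)
      finally show ?thesis .
    qed
    ultimately show ?thesis by simp
  qed
  have fin: "finite {p. fst p + 2 * snd p = m}" for m :: nat
  proof (rule finite_subset)
    show "{p. fst p + 2 * snd p = m} \<subseteq> {..m} \<times> {..m}" by auto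
  qed simp
  have fibre: "(\<Sum>p | fst p + 2 * snd p = m. f p) = gegenbauer v m x * w ^ m" for m
  proof -
    have "gegenbauer v m x * w ^ m = (\<Sum>k\<le>m. connection_coeff v l (m - k) k * (of_int (int m - 2 * int k) +
        l) * gegenbauer_int l (int m - 2 * int k) x * w ^ m)"
      unfolding gegenbauer_connection[OF l, of v m x] by (rule sum_distrib_right)
    also have "\<dots> = (\<Sum>k\<in>{k. 2 * k \<le> m}. connection_coeff v l (m - k) k * (of_int (int m - 2 * int k) + l) *
        gegenbauer_int l (int m - 2 * int k) x * w ^ m)"
      by (intro sum.mono_neutral_right) (auto simp: gegenbauer_int_def)
    also have "\<dots> = (\<Sum>k\<in>{k. 2 * k \<le> m}. f (m - 2 * k, k))"
    proof (intro sum.cong refl)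
      fix k assume "k \<in> {k. 2 * k \<le> m}"
      then obtain n where m: "m = n + 2 * k" by (metis le_add_diff_inverse2 mem_Collect_eq)
      show "connection_coeff v l (m - k) k * (of_int (int m - 2 * int k) + l) * gegenbauer_int l (int m -
          2 * int k) x * w ^ m = f (m - 2 * k, k)"
        by (simp add: m f_def gegenbauer_int_def add.commute[of k n])
    qed
    also have "\<dots> = (\<Sum>p | fst p + 2 * snd p = m. f p)"
      by (rule sum.reindex_bij_witness[of _ snd "\<lambda>k. (m - 2 * k, k)"]) auto
    finally show ?thesis by simp
  qed
  have "(\<lambda>m. gegenbauer v m x * w ^ m) sums infsum f UNIV"
    using sums_over_fibres[OF sm fin] unfolding fibre .
  with gegenbauer_generating_function(1)[OF r(1,2) w(1,2), of v]
  have "infsum f UNIV = (1 - 2 * x * w + w ^ 2) powr (- v)" by (metis sums_unique2)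
  then show ?thesis using sums_over_rows[OF sm row] by simp
qed

text \<open>
  In the product of the two Legendre functions the Gamma factors collapse, by Legendre's duplication
  formula, to the single constant \<open>\<Gamma>(m + 1/2)\<close>.
\<close>
lemma Legendre_product_eq:
  assumes m: "2 * m + 1 \<notin> \<int>\<^sub>\<le>\<^sub>0"
    and z: "z \<notin> complex_of_real ` {..1}" and x: "x \<notin> complex_of_real ` ({..-1} \<union> {1..})"
  shows "(2 * m + 2 * of_nat n + 1) * pochhammer v n * Gamma (2 * m + of_nat n + 1) / fact n
              * Ferrers_P (of_nat n + m) (- m) x * Olver_Q (of_nat n + m) (v - m - 1) z =
    (1 - x\<^sup>2) powr (m / 2) * sq_minus_one_powr z ((v - m - 1) / 2) * (2 * joukowski z) powr v *
    (Gamma (m + 1 / 2) * (of_nat n + (m + 1 / 2)) * pochhammer v n * gegenbauer (m + 1 / 2) n x *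
        joukowski z ^ n
      * hyp2F1_reg (of_nat n + v) (v - (m + 1 / 2)) (of_nat n + (m + 1 / 2) + 1) (joukowski z ^ 2))"
proof -
  define l p where "l = m + 1 / 2" and "p = joukowski z"
  have l2: "2 * l = 2 * m + 1" by (simp add: l_def)
  have l: "l \<notin> \<int>\<^sub>\<le>\<^sub>0" "l + 1 / 2 \<notin> \<int>\<^sub>\<le>\<^sub>0"
    using half_notin_nonpos_Ints[of l] m unfolding l2 by auto
  have p: "p \<noteq> 0" using joukowski[OF z] by (simp add: p_def)
  have nz: "pochhammer (2 * m + 1) n \<noteq> 0" using m by (auto dest: pochhammer_eq_0_imp_nonpos_Int)
  have c: "of_nat n + m + 3 / 2 \<notin> \<int>\<^sub>\<le>\<^sub>0"
    using add_of_nat_notin_nonpos_Ints[OF l(1), of "Suc n"] by (simp add: l_def algebra_simps)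
  have G: "Gamma (2 * m + of_nat n + 1) = pochhammer (2 * m + 1) n * Gamma (2 * m + 1)"
    using pochhammer_Gamma[OF m, of n] m by (simp add: Gamma_eq_zero_iff field_simps)
  have dup: "Gamma (2 * m + 1) * rGamma (m + 1) * of_real (sqrt pi) * 2 powr (- 2 * m) = Gamma l"
  proof -
    have "Gamma l * Gamma (m + 1) = exp (- 2 * m * of_real (ln 2)) * of_real (sqrt pi) * Gamma (2 * m + 1)"
      using Gamma_legendre_duplication[OF l] by (simp add: l_def add_ac)
    moreover have "exp (- 2 * m * of_real (ln 2)) = 2 powr (- 2 * m)"
      by (simp add: powr_def flip: Ln_of_real)
    moreover have "Gamma (m + 1) \<noteq> 0" using l(2) by (simp add: l_def Gamma_eq_zero_iff add_ac)
    ultimately show ?thesis by (simp add: rGamma_inverse_Gamma field_simps)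
  qed
  have pw: "(2 * p) powr (of_nat n + v) / 2 powr (of_nat n + m + 1) * 2 powr (- m) = (2 * p) powr v * p ^
      n * 2 powr (- 2 * m) / 2"
  proof -
    have "(2 * p) powr (of_nat n + v) = (2 * p) ^ n * (2 * p) powr v"
      using p by (simp add: powr_add powr_nat')
    moreover have "2 powr (of_nat n + m + 1) = 2 ^ n * 2 powr m * (2::complex)"
      by (simp add: powr_add powr_nat')
    moreover have "2 powr (- 2 * m) = 2 powr (- m) / (2::complex) powr m"
      using powr_diff[of 2 "- m" m] by simp
    ultimately show ?thesis by (simp add: power_mult_distrib)
  qed
  have Q: "Olver_Q (of_nat n + m) (v - m - 1) z = of_real (sqrt pi) * sq_minus_one_powr z ((v - m - 1) /
      2) / 2 powr (of_nat n + m + 1) *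
     (2 * p) powr (of_nat n + v) * hyp2F1_reg (of_nat n + v) (v - l) (of_nat n + l + 1) (p ^ 2)"
    unfolding Olver_Q_eq[OF c z] l_def p_def by (simp add: algebra_simps)
  have "(2 * m + 2 * of_nat n + 1) * pochhammer v n * Gamma (2 * m + of_nat n + 1) / fact n
              * Ferrers_P (of_nat n + m) (- m) x * Olver_Q (of_nat n + m) (v - m - 1) z =
      2 * (of_nat n + l) * pochhammer v n * ((1 - x\<^sup>2) powr (m / 2) * sq_minus_one_powr z ((v - m - 1) /
          2)) * gegenbauer l n x
      * hyp2F1_reg (of_nat n + v) (v - l) (of_nat n + l + 1) (p ^ 2)
      * (Gamma (2 * m + 1) * rGamma (m + 1) * of_real (sqrt pi))
      * ((2 * p) powr (of_nat n + v) / 2 powr (of_nat n + m + 1) * 2 powr (- m))"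
    unfolding Ferrers_P_eq_gegenbauer[OF m x] Q G using nz by (simp add: l_def field_simps)
  also have "\<dots> = (1 - x\<^sup>2) powr (m / 2) * sq_minus_one_powr z ((v - m - 1) / 2) * (2 * p) powr v *
     (Gamma l * (of_nat n + l) * pochhammer v n * gegenbauer l n x * p ^ n
      * hyp2F1_reg (of_nat n + v) (v - l) (of_nat n + l + 1) (p ^ 2))"
    unfolding pw dup[symmetric] by (simp add: mult_ac)
  finally show ?thesis unfolding l_def p_def .
qed

theorem corollary3p4:
  fixes \<nu> \<mu> z x :: complex and s :: real
  assumes "2 * \<mu> + 1 \<notin> \<int>\<^sub>\<le>\<^sub>0"
    and "s > 2"
    and "z \<in> confocal_ellipse s" and "z \<notin> complex_of_real ` {..1}"
    and "x \<in> confocal_ellipse_interior s" and "x \<notin> complex_of_real ` ({..-1} \<union> {1..})"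
  shows "(\<lambda>n. (2 * \<mu> + 2 * of_nat n + 1) * pochhammer \<nu> n * Gamma (2 * \<mu> + of_nat n + 1) / fact n
              * Ferrers_P (of_nat n + \<mu>) (- \<mu>) x
              * Olver_Q (of_nat n + \<mu>) (\<nu> - \<mu> - 1) z)
         sums ((1 - x\<^sup>2) powr (\<mu> / 2) * sq_minus_one_powr z ((\<nu> - \<mu> - 1) / 2)
               * diff_powr s z (- \<nu>) x)"
proof -
  obtain r r' where r: "r * r' = 1" "r + r' = 2 * x" "norm r \<ge> 1"
    "norm (r * joukowski z) < 1" "norm (r' * joukowski z) < 1"
    using ellipse_interior_param[OF assms(3,4,5)] by metis
  have "\<mu> + 1 / 2 \<notin> \<int>\<^sub>\<le>\<^sub>0"
    using half_notin_nonpos_Ints(2)[of "\<mu> + 1 / 2"] assms(1) by (simp add: algebra_simps)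
  from sums_mult[OF gegenbauer_expansion[OF this r joukowski(3)[OF assms(4)]],
      of "(1 - x\<^sup>2) powr (\<mu> / 2) * sq_minus_one_powr z ((\<nu> - \<mu> - 1) / 2) * (2 * joukowski z) powr \<nu>" \<nu>]
  show ?thesis
    unfolding Legendre_product_eq[OF assms(1,4,6)] diff_powr_eq[OF assms(2-5)] minus_minus by (simp only: mult.assoc)
qed

end
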